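(* For $C>0$ sufficiently small (i.e. there exists $C_0>0$ such that for all $0<C\le C_0$), $$\mathbb{P}\left(\exists\, \tau\in[0,1] \text{ such that } \limsup_{t\to\infty}\frac{S_0^{\tau}(t)}{\sqrt{t\log(t)}}\ge C\right)=1 .$$
   Context: Dynamical discrete web (DyDW): let $\mathbb{Z}^2_{\mathrm{even}}=\{(x,t)\in\mathbb{Z}^2: x+t \text{ even}\}$, where $x$ is space and $t$ is (random walk) time. To each $z\in\mathbb{Z}^2_{\mathrm{even}}$ assign, independently over $z$, a right-continuous process $(\xi_z^\tau)_{\tau\ge 0}$ with values in $\{-1,+1\}$: $\xi_z^0$ is uniform on $\{\pm1\}$, and at each ring of a rate one Poisson clock attached to $z$ the value is replaced by a fresh independent uniform $\pm1$ variable (which may agree with the old value). All clocks, initial values and resampled values are independent. The parameter $\tau$ is called dynamical time. For fixed $\tau$, draw an arrow from each $(x,t)\in\mathbb{Z}^2_{\mathrm{even}}$ to $(x+\xi_{(x,t)}^\tau,t+1)$; $S_{z}^{\tau}(\cdot)$ denotes the path that starts at $z$ and follows the arrows at dynamical time $\tau$ (linearly interpolated between integer times). $S_0^\tau:=S_{(0,0)}^\tau$ is the path from the origin. *)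

theory Defs
  imports "HOL-Probability.Probability"
begin

definition Z2even :: "(int \<times> int) set" where
  "Z2even = {(x, t). even (x + t)}"

text \<open>
  The randomness driving the dynamical discrete web. For a site \<open>z = (x, t)\<close> (space, time),
  \<open>mark z 0\<close> is the initial arrow at \<open>z\<close>, \<open>mark z (Suc n)\<close> is the fresh value drawn at ring
  number \<open>n\<close> (counted from 0) of the clock at \<open>z\<close>, and \<open>gap z n\<close> is the waiting time that ends
  with that ring; i.i.d. exponential waiting times of parameter 1 give a Poisson clock of rate one.
  Sites outside \<open>Z2even\<close> carry no arrow and are left unconstrained. The marks are embedded into
  the reals in \<open>independence\<close> because \<open>indep_vars\<close> needs one value type for the whole family.
\<close>

locale dynamical_discrete_web = prob_space M for M :: "'a measure" +
  fixes mark :: "int \<times> int \<Rightarrow> nat \<Rightarrow> 'a \<Rightarrow> int"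
    and gap :: "int \<times> int \<Rightarrow> nat \<Rightarrow> 'a \<Rightarrow> real"
  assumes mark_measurable:
      "\<And>z n. z \<in> Z2even \<Longrightarrow> random_variable (count_space {-1, 1}) (mark z n)"
    and mark_uniform:
      "\<And>z n. z \<in> Z2even \<Longrightarrow>
        distr M (count_space {-1, 1}) (mark z n) = uniform_count_measure {-1, 1}"
    and gap_exponential:
      "\<And>z n. z \<in> Z2even \<Longrightarrow> distributed M lborel (gap z n) (exponential_density 1)"
    and independence:
      "indep_vars (\<lambda>_. borel)
        (case_sum (\<lambda>(z, n) \<omega>. real_of_int (mark z n \<omega>)) (\<lambda>(z, n). gap z n))
        ((Z2even \<times> UNIV) <+> (Z2even \<times> UNIV))"

definition ring_time :: "(int \<times> int \<Rightarrow> nat \<Rightarrow> 'a \<Rightarrow> real) \<Rightarrow> int \<times> int \<Rightarrow> nat \<Rightarrow> 'a \<Rightarrow> real" where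
  "ring_time gap z n \<omega> = (\<Sum>k\<le>n. gap z k \<omega>)"

text \<open>
  The arrow at \<open>z\<close> at dynamical time \<open>\<tau>\<close> is the mark indexed by the number of rings in \<open>[0, \<tau>]\<close>.
  Counting rings at time \<open>\<tau>\<close> itself makes the process right-continuous. Almost surely the
  counted set is finite for all \<open>z\<close> and \<open>\<tau>\<close>; elsewhere \<open>card\<close> is the junk value 0.
\<close>

definition arrow ::
  "(int \<times> int \<Rightarrow> nat \<Rightarrow> 'a \<Rightarrow> int) \<Rightarrow> (int \<times> int \<Rightarrow> nat \<Rightarrow> 'a \<Rightarrow> real) \<Rightarrow>
    int \<times> int \<Rightarrow> real \<Rightarrow> 'a \<Rightarrow> int" where
  "arrow mark gap z \<tau> \<omega> = mark z (card {n. ring_time gap z n \<omega> \<le> \<tau>}) \<omega>"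

definition follow_arrow ::
  "(int \<times> int \<Rightarrow> nat \<Rightarrow> 'a \<Rightarrow> int) \<Rightarrow> (int \<times> int \<Rightarrow> nat \<Rightarrow> 'a \<Rightarrow> real) \<Rightarrow>
    real \<Rightarrow> 'a \<Rightarrow> int \<times> int \<Rightarrow> int \<times> int" where
  "follow_arrow mark gap \<tau> \<omega> z = (fst z + arrow mark gap z \<tau> \<omega>, snd z + 1)"

text \<open>
  \<open>web_path mark gap z \<tau> \<omega> s\<close> is the position at real time \<open>s \<ge> snd z\<close> of the path that starts
  at \<open>z\<close>, linearly interpolated between integer times; for \<open>s < snd z\<close> it is meaningless.
\<close>

definition web_path ::
  "(int \<times> int \<Rightarrow> nat \<Rightarrow> 'a \<Rightarrow> int) \<Rightarrow> (int \<times> int \<Rightarrow> nat \<Rightarrow> 'a \<Rightarrow> real) \<Rightarrow>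
    int \<times> int \<Rightarrow> real \<Rightarrow> 'a \<Rightarrow> real \<Rightarrow> real" where
  "web_path mark gap z \<tau> \<omega> s =
    (let X = (\<lambda>k. real_of_int (fst ((follow_arrow mark gap \<tau> \<omega> ^^ k) z)));
         k = nat \<lfloor>s - real_of_int (snd z)\<rfloor>;
         r = frac (s - real_of_int (snd z))
     in (1 - r) * X k + r * X (Suc k))"

end

theory Submission
  imports Defs "HOL-Real_Asymp.Real_Asymp"
begin

text \<open>
  Fix a dynamical interval and \<open>N\<close> equally spaced times in it, and put \<open>n = N ^ 4\<close>. The average \<open>Z\<close> of
  the exponential martingales \<open>exp (\<beta> * S n) / cosh \<beta> ^ n\<close> over these times, with \<open>\<beta>\<close> of order
  \<open>sqrt (ln n / n)\<close>, has mean 1. Its second moment tends to 1: two paths move independently while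
  apart, and when they meet they separate quickly because the arrows have had time \<open>1 / N\<close> to be
  resampled, so that a small spatial perturbation \<open>1 + a * exp (- \<theta> * \<bar>x - y\<bar>)\<close> of the product weight is a
  supersolution of the pair chain. By Chebyshev's inequality \<open>Z\<close> exceeds \<open>1 / 2\<close> with probability tending
  to 1, which forces one of the paths to be of order \<open>sqrt (n * ln n)\<close> at time \<open>n\<close>. Hence, almost surely,
  the dynamical times with a high path beyond any given level are dense, and by right-continuity
  they contain dense open sets; Baire's theorem yields a time that is high infinitely often.
\<close>

section \<open>Walks along arrows\<close>

text \<open>The arrow field is a free argument: the same recursion then serves for the web, for its
  restriction to the even sites, and for coordinates of a product space in the independence
  proofs.\<close>

fun walk :: "(int \<times> int \<Rightarrow> int) \<Rightarrow> nat \<Rightarrow> int" where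
  "walk v 0 = 0"
| "walk v (Suc n) = walk v n + v (walk v n, int n)"

lemma follow_arrow_funpow:
  "(follow_arrow mark gap \<tau> \<omega> ^^ n) (0, 0) = (walk (\<lambda>z. arrow mark gap z \<tau> \<omega>) n, int n)"
  by (induction n) (auto simp: follow_arrow_def)

lemma web_path_of_nat:
  "web_path mark gap (0, 0) \<tau> \<omega> (real n) = real_of_int (walk (\<lambda>z. arrow mark gap z \<tau> \<omega>) n)"
  by (simp add: web_path_def Let_def follow_arrow_funpow frac_def)

lemma walk_bound:
  assumes "\<And>z. z \<in> Z2even \<Longrightarrow> v z \<in> {-1, 1}"
  shows "(walk v n, int n) \<in> Z2even \<and> \<bar>walk v n\<bar> \<le> int n"
proof (induction n)
  case 0 then show ?case by (simp add: Z2even_def)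
next
  case (Suc n)
  have "v (walk v n, int n) \<in> {-1, 1}" using Suc assms by blast
  then show ?case using Suc by (auto simp: Z2even_def)
qed

text \<open>Finitely many sites decide the path from the origin up to time \<open>n\<close>; this
  lets right-continuity pass from single arrows to paths.\<close>

definition light_cone :: "nat \<Rightarrow> (int \<times> int) set" where
  "light_cone n = {z \<in> Z2even. \<bar>fst z\<bar> \<le> int n \<and> 0 \<le> snd z \<and> snd z < int n}"

lemma finite_light_cone: "finite (light_cone n)"
proof (rule finite_subset)
  show "light_cone n \<subseteq> {-int n..int n} \<times> {0..int n}" by (auto simp: light_cone_def)
qed simp

text \<open>By induction the \<open>v\<close>-walk leaves only sites of \<open>light_cone n\<close>
  before time \<open>n\<close>, and the \<open>v'\<close>-walk copies it. Only \<open>v\<close> has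
  to take signs, so \<open>v'\<close> may be a field set to 0 at irrelevant sites.\<close>

lemma walk_cong:
  assumes "\<And>z. z \<in> Z2even \<Longrightarrow> v z \<in> {-1, 1}" "\<And>z. z \<in> light_cone n \<Longrightarrow> v' z = v z" "m \<le> n"
  shows "walk v' m = walk v m"
  using assms(3)
proof (induction m)
  case (Suc m)
  have "(walk v m, int m) \<in> light_cone n"
    using walk_bound[of v m] assms(1) Suc.prems by (auto simp: light_cone_def)
  then show ?case using Suc assms(2) by simp
qed simp

lemma measurable_walk:
  assumes "\<And>z. (\<lambda>\<omega>. v \<omega> z) \<in> measurable N (count_space UNIV)"
  shows "(\<lambda>\<omega>. walk (v \<omega>) n) \<in> measurable N (count_space UNIV)"
proof (induction n)
  case (Suc n)
  have "(\<lambda>\<omega>. (\<lambda>i. i + v \<omega> (i, int n)) (walk (v \<omega>) n)) \<in> measurable N (count_space UNIV)"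
    by (rule measurable_compose_countable[OF _ Suc]) (use assms in measurable)
  then show ?case by simp
qed simp

section \<open>Random indices and finitely valued random variables\<close>

text \<open>Split according to the value of \<open>W\<close>: each \<open>i\<close> in
  \<open>D\<close> contributes the same factor \<open>c\<close>. This evaluates marks that are read
  at random ring counts.\<close>

lemma (in prob_space) prob_at_random_index:
  fixes W :: "'a \<Rightarrow> 'i::countable"
  assumes [measurable]: "W \<in> measurable M (count_space UNIV)"
    and [measurable]: "\<And>i. Measurable.pred M (E i)"
    and eq: "\<And>i. i \<in> D \<Longrightarrow> prob {\<omega> \<in> space M. E i \<omega> \<and> W \<omega> = i} = c * prob {\<omega> \<in> space M. W \<omega> = i}"
    and c: "0 \<le> c"
  shows "prob {\<omega> \<in> space M. E (W \<omega>) \<omega> \<and> W \<omega> \<in> D} = c * prob {\<omega> \<in> space M. W \<omega> \<in> D}"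
proof -
  have UN: "{\<omega> \<in> space M. E (W \<omega>) \<omega> \<and> W \<omega> \<in> D} = (\<Union>i\<in>D. {\<omega> \<in> space M. E i \<omega> \<and> W \<omega> = i})"
    "{\<omega> \<in> space M. W \<omega> \<in> D} = (\<Union>i\<in>D. {\<omega> \<in> space M. W \<omega> = i})" by auto
  have "emeasure M {\<omega> \<in> space M. E (W \<omega>) \<omega> \<and> W \<omega> \<in> D}
      = (\<integral>\<^sup>+i. emeasure M {\<omega> \<in> space M. E i \<omega> \<and> W \<omega> = i} \<partial>count_space D)"
    unfolding UN by (rule emeasure_UN_countable) (auto simp: disjoint_family_on_def)
  also have "\<dots> = (\<integral>\<^sup>+i. ennreal c * emeasure M {\<omega> \<in> space M. W \<omega> = i} \<partial>count_space D)"
    by (rule nn_integral_cong) (auto simp: emeasure_eq_measure eq c ennreal_mult)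
  also have "\<dots> = ennreal c * (\<integral>\<^sup>+i. emeasure M {\<omega> \<in> space M. W \<omega> = i} \<partial>count_space D)"
    by (rule nn_integral_cmult) auto
  also have "(\<integral>\<^sup>+i. emeasure M {\<omega> \<in> space M. W \<omega> = i} \<partial>count_space D) = emeasure M {\<omega> \<in> space M. W \<omega> \<in> D}"
    unfolding UN by (rule emeasure_UN_countable[symmetric]) (auto simp: disjoint_family_on_def)
  finally show ?thesis using c by (simp add: emeasure_eq_measure ennreal_mult[symmetric])
qed

lemma (in prob_space) expectation_finite_values:
  fixes h :: "'s \<Rightarrow> real"
  assumes [measurable]: "F \<in> measurable M (count_space UNIV)"
    and S: "finite S" "\<And>\<omega>. \<omega> \<in> space M \<Longrightarrow> F \<omega> \<in> S"
  shows "integrable M (\<lambda>\<omega>. h (F \<omega>))"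
    and "expectation (\<lambda>\<omega>. h (F \<omega>)) = (\<Sum>s\<in>S. prob {\<omega> \<in> space M. F \<omega> = s} * h s)"
proof -
  have eq: "h (F \<omega>) = (\<Sum>s\<in>S. indicator {\<omega> \<in> space M. F \<omega> = s} \<omega> * h s)" if "\<omega> \<in> space M" for \<omega>
  proof -
    have "(\<Sum>s\<in>S. indicator {\<omega> \<in> space M. F \<omega> = s} \<omega> * h s) = (\<Sum>s\<in>S. if F \<omega> = s then h s else 0)"
      using that by (intro sum.cong) (auto simp: indicator_def)
    also have "\<dots> = h (F \<omega>)" using S that by simp
    finally show ?thesis by simp
  qed
  have int: "integrable M (\<lambda>\<omega>. \<Sum>s\<in>S. indicator {\<omega> \<in> space M. F \<omega> = s} \<omega> * h s)"
    by (intro Bochner_Integration.integrable_sum integrable_mult_left integrable_real_indicator)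
      (auto simp: emeasure_eq_measure)
  show "integrable M (\<lambda>\<omega>. h (F \<omega>))"
    using int by (rule Bochner_Integration.integrable_cong[THEN iffD1, rotated -1]) (auto simp: eq)
  have "expectation (\<lambda>\<omega>. h (F \<omega>)) = expectation (\<lambda>\<omega>. \<Sum>s\<in>S. indicator {\<omega> \<in> space M. F \<omega> = s} \<omega> * h s)"
    by (rule Bochner_Integration.integral_cong) (auto simp: eq)
  also have "\<dots> = (\<Sum>s\<in>S. prob {\<omega> \<in> space M. F \<omega> = s} * h s)"
    by (subst Bochner_Integration.integral_sum)
      (auto intro!: integrable_mult_left integrable_real_indicator sum.cong
        simp: emeasure_eq_measure Int_absorb1 Collect_mono_iff)
  finally show "expectation (\<lambda>\<omega>. h (F \<omega>)) = (\<Sum>s\<in>S. prob {\<omega> \<in> space M. F \<omega> = s} * h s)" .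
qed

section \<open>The pair chain and exponential moments\<close>

lemma sum_signs:
  "(\<Sum>(e, e')\<in>{-1, 1} \<times> {-1, 1}. f e e') = f (-1) (-1) + f (-1) 1 + f 1 (-1) + (f 1 1 :: real)"
  for f :: "int \<Rightarrow> int \<Rightarrow> real"
  by (simp add: sum.cartesian_product[symmetric])

lemma cosh_power2_exp: "(cosh x)\<^sup>2 = (exp (2 * x) + exp (- (2 * x)) + 2) / 4" for x :: real
  using cosh_double_cosh[of x] by (simp add: cosh_field_def)

text \<open>The sum is the mean of \<open>w\<close> after one step of the pair chain,
  \<open>c\<close> being the correlation of the two arrows. Off the diagonal the arrows are
  uncorrelated and the perturbation only costs a factor \<open>(cosh \<theta>)\<^sup>2\<close>. On
  the diagonal the correlation adds at most \<open>(1 + a) * (sinh \<beta>)\<^sup>2\<close>, up to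
  the common exponential factor; by \<open>small\<close> the drop of the perturbation when the paths
  separate pays for it.\<close>

lemma supersolution:
  fixes x y :: int and \<beta> \<theta> a c :: real
  defines "w \<equiv> \<lambda>x y :: int. exp (\<beta> * real_of_int (x + y)) * (1 + a * exp (- \<theta> * \<bar>real_of_int (x - y)\<bar>))"
  assumes "even (x - y)" and a: "0 \<le> a" and c: "x \<noteq> y \<Longrightarrow> c = 0" "0 \<le> c" "c \<le> 1"
    and small: "x = y \<Longrightarrow> (1 + a) * (sinh \<beta>)\<^sup>2 \<le> (1 - c) / 2 * (a * (1 - exp (- 2 * \<theta>)))"
  shows "(\<Sum>(e, e')\<in>{-1, 1} \<times> {-1, 1}. (1 + c * real_of_int (e * e')) / 4 * w (x + e) (y + e'))
    \<le> (cosh \<beta>)\<^sup>2 * (cosh \<theta>)\<^sup>2 * w x y"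
proof -
  define S where "S = exp (\<beta> * real_of_int (x + y))"
  define P where "P = exp (2 * \<beta>) + exp (- (2 * \<beta>))"
  have S: "exp (\<beta> * real_of_int (x + 1 + (y + 1))) + exp (\<beta> * real_of_int (x - 1 + (y - 1))) = S * P"
    by (simp add: S_def P_def exp_add[symmetric] algebra_simps)
  have S0: "S > 0" by (simp add: S_def)
  have D1: "(cosh \<theta>)\<^sup>2 \<ge> 1" and C1: "(cosh \<beta>)\<^sup>2 \<ge> 1"
    by (simp_all add: cosh_square_eq)
  have P: "P = 4 * (cosh \<beta>)\<^sup>2 - 2" unfolding P_def cosh_power2_exp by (simp add: field_simps)
  show ?thesis
  proof (cases "x = y")
    case False
    define u where "u = exp (- \<theta> * \<bar>real_of_int (x - y)\<bar>)"
    have u: "u > 0" by (simp add: u_def)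
    \<comment> \<open>Opposite steps change the difference by 2. By parity the difference is at
      least 2 in absolute value, so it cannot change sign and the absolute value is linear on these
      steps.\<close>
    have *: "exp (- \<theta> * \<bar>real_of_int (x + 1 - (y - 1))\<bar>) + exp (- \<theta> * \<bar>real_of_int (x - 1 - (y + 1))\<bar>)
      = u * (4 * (cosh \<theta>)\<^sup>2 - 2)"
    proof (cases "x > y")
      case True
      then have "x - y \<ge> 2" using \<open>even (x - y)\<close> by (smt (verit) oddE even_zero odd_one)
      then have "\<bar>real_of_int (x + 1 - (y - 1))\<bar> = real_of_int (x - y) + 2"
        "\<bar>real_of_int (x - 1 - (y + 1))\<bar> = real_of_int (x - y) - 2" "\<bar>real_of_int (x - y)\<bar> = real_of_int (x - y)" by linarith+
      then show ?thesis
        unfolding cosh_power2_exp u_def by (simp add: algebra_simps exp_add[symmetric])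
    next
      case F: False
      then have "x - y \<le> -2" using \<open>even (x - y)\<close> False by (smt (verit) even_minus odd_one)
      then have "\<bar>real_of_int (x + 1 - (y - 1))\<bar> = - real_of_int (x - y) - 2"
        "\<bar>real_of_int (x - 1 - (y + 1))\<bar> = - real_of_int (x - y) + 2" "\<bar>real_of_int (x - y)\<bar> = - real_of_int (x - y)" by linarith+
      then show ?thesis
        unfolding cosh_power2_exp u_def by (simp add: algebra_simps exp_add[symmetric])
    qed
    have "(\<Sum>(e, e')\<in>{-1, 1} \<times> {-1, 1}. (1 + c * real_of_int (e * e')) / 4 * w (x + e) (y + e'))
      = 1 / 4 * ((exp (\<beta> * real_of_int (x + 1 + (y + 1))) + exp (\<beta> * real_of_int (x - 1 + (y - 1)))) * (1 + a * u)
        + S * (2 + a * (exp (- \<theta> * \<bar>real_of_int (x + 1 - (y - 1))\<bar>) + exp (- \<theta> * \<bar>real_of_int (x - 1 - (y + 1))\<bar>))))"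
      unfolding sum_signs w_def u_def S_def using c(1)[OF False] by (simp add: algebra_simps)
    also have "\<dots> = S * (((cosh \<beta>)\<^sup>2 - 1/2) * (1 + a * u) + 1/2 + a * u * ((cosh \<theta>)\<^sup>2 - 1/2))"
      unfolding * S P by (simp add: field_simps)
    also have "\<dots> \<le> S * ((cosh \<beta>)\<^sup>2 * (cosh \<theta>)\<^sup>2 * (1 + a * u))"
    proof (rule mult_left_mono)
      \<comment> \<open>The left-hand side of the bound is \<open>(cosh \<beta>)\<^sup>2 * (1 + a *
        u) + a * u * ((cosh \<theta>)\<^sup>2 - 1)\<close>; only its last term has to be
        estimated.\<close>
      have "a * u * ((cosh \<theta>)\<^sup>2 - 1) \<le> (1 + a * u) * ((cosh \<theta>)\<^sup>2 - 1)"
        using D1 by (intro mult_right_mono) auto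
      also have "\<dots> \<le> (cosh \<beta>)\<^sup>2 * ((1 + a * u) * ((cosh \<theta>)\<^sup>2 - 1))"
        using mult_right_mono[OF C1, of "(1 + a * u) * ((cosh \<theta>)\<^sup>2 - 1)"] D1 a u by simp
      finally show "((cosh \<beta>)\<^sup>2 - 1/2) * (1 + a * u) + 1/2 + a * u * ((cosh \<theta>)\<^sup>2 - 1/2)
          \<le> (cosh \<beta>)\<^sup>2 * (cosh \<theta>)\<^sup>2 * (1 + a * u)"
        by (simp add: field_simps)
    qed (use S0 in simp)
    finally show ?thesis by (simp add: w_def S_def u_def mult_ac)
  next
    case True
    have "(\<Sum>(e, e')\<in>{-1, 1} \<times> {-1, 1}. (1 + c * real_of_int (e * e')) / 4 * w (x + e) (y + e'))
      = 1 / 4 * ((1 + c) * ((exp (\<beta> * real_of_int (x + 1 + (y + 1))) + exp (\<beta> * real_of_int (x - 1 + (y - 1)))) * (1 + a))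
        + (1 - c) * (S * (2 + 2 * a * exp (- 2 * \<theta>))))"
      unfolding sum_signs w_def S_def using True by (simp add: algebra_simps add_divide_distrib)
    also have "\<dots> = S * ((1 + c) * ((cosh \<beta>)\<^sup>2 - 1/2) * (1 + a) + (1 - c) / 2 * (1 + a * exp (- 2 * \<theta>)))"
      unfolding S P by (simp add: field_simps)
    also have "\<dots> \<le> S * ((cosh \<beta>)\<^sup>2 * (cosh \<theta>)\<^sup>2 * (1 + a))"
    proof (rule mult_left_mono)
      \<comment> \<open>The left-hand side of the bound is \<open>(1 + a) * ((cosh \<beta>)\<^sup>2
        + c * (sinh \<beta>)\<^sup>2) - (1 - c) / 2 * (a * (1 - exp (- 2 *
        \<theta>)))\<close>.\<close>
      have "(1 + a) * (c * (sinh \<beta>)\<^sup>2) \<le> (1 + a) * (1 * (sinh \<beta>)\<^sup>2)"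
        using a c by (intro mult_left_mono mult_right_mono) auto
      also have "\<dots> \<le> (1 - c) / 2 * (a * (1 - exp (- 2 * \<theta>)))" using small True by simp
      finally have "(1 + c) * ((cosh \<beta>)\<^sup>2 - 1/2) * (1 + a) + (1 - c) / 2 * (1 + a * exp (- 2 * \<theta>))
          \<le> (cosh \<beta>)\<^sup>2 * (1 + a)"
        unfolding cosh_square_eq by (simp add: field_simps)
      also have "\<dots> \<le> (cosh \<theta>)\<^sup>2 * ((cosh \<beta>)\<^sup>2 * (1 + a))"
        using mult_right_mono[OF D1, of "(cosh \<beta>)\<^sup>2 * (1 + a)"] a by simp
      finally show "(1 + c) * ((cosh \<beta>)\<^sup>2 - 1/2) * (1 + a) + (1 - c) / 2 * (1 + a * exp (- 2 * \<theta>))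
          \<le> (cosh \<beta>)\<^sup>2 * (cosh \<theta>)\<^sup>2 * (1 + a)" by (simp add: mult_ac)
    qed (use S0 in simp)
    finally show ?thesis using True by (simp add: w_def S_def mult_ac)
  qed
qed

section \<open>Parameters and their asymptotics\<close>

text \<open>
  At time \<open>n = N ^ 4\<close> the parameters of the header are \<open>\<beta> = tilt N\<close>, \<open>a = N powr (-1/4)\<close> and
  \<open>\<theta> = N powr (-5/2)\<close>: then \<open>n * \<theta>\<^sup>2\<close> and \<open>exp (4 * n * \<beta>\<^sup>2) / N\<close> vanish, and \<open>\<beta>\<^sup>2\<close> is small
  against \<open>a * \<theta> / N\<close>.
\<close>

definition tilt :: "nat \<Rightarrow> real" where
  "tilt N = sqrt (ln (real N) / 8) / real N ^ 2"

text \<open>The factor \<open>1 / 8\<close> is chosen so that, with \<open>n = N ^ 4\<close>,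
  \<open>exp (4 * n * (tilt N)\<^sup>2)\<close> is the square root of \<open>N\<close>, which
  averaging over \<open>N\<close> times absorbs.\<close>

lemma tilt_square: "0 < N \<Longrightarrow> (tilt N)\<^sup>2 * real (N ^ 4) = ln (real N) / 8"
  by (simp add: tilt_def power_divide flip: power_mult)

lemma tilt_at_right: "filterlim tilt (at_right 0) sequentially"
  unfolding tilt_def by real_asymp

text \<open>\<open>d / (real N + 1)\<close> is the spacing of \<open>N\<close> times in an interval
  of length \<open>d\<close>, and 6 is the constant of \<open>expectation_exp_pos_pos_le\<close>.
  The left side is of order \<open>ln N / N ^ 4\<close>, the right side of the larger order
  \<open>N powr (-15/4)\<close>.\<close>

lemma eventually_tilt_small:
  fixes d :: real
  assumes "0 < d"
  shows "\<forall>\<^sub>F N in sequentially. (1 + real N powr (-1/4)) * (sinh (tilt N))\<^sup>2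
    \<le> d / (real N + 1) / 6 * (real N powr (-1/4) * (1 - exp (-2 * real N powr (-5/2))))"
  using assms unfolding sinh_field_def tilt_def by real_asymp

text \<open>The leading exponent at 0 is \<open>2 * x\<^sup>2\<close>; a slack of a factor 2, here
  and in the next two lemmas, lets the second-order expansion decide.\<close>

lemma eventually_cosh_tilt_le: "\<forall>\<^sub>F N in sequentially. cosh (2 * tilt N) \<le> exp (4 * (tilt N)\<^sup>2)"
proof -
  have "\<forall>\<^sub>F x in at_right (0::real). cosh (2 * x) \<le> exp (4 * x\<^sup>2)"
    unfolding cosh_field_def by real_asymp
  then show ?thesis by (rule eventually_compose_filterlim[OF _ tilt_at_right])
qed

lemma eventually_cosh_tilt_ge: "\<forall>\<^sub>F N in sequentially. exp ((tilt N)\<^sup>2 / 4) \<le> cosh (tilt N)"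
proof -
  have "\<forall>\<^sub>F x in at_right (0::real). exp (x\<^sup>2 / 4) \<le> cosh x"
    unfolding cosh_field_def by real_asymp
  then show ?thesis by (rule eventually_compose_filterlim[OF _ tilt_at_right])
qed

lemma eventually_cosh_powr_le:
  "\<forall>\<^sub>F N in sequentially. cosh (real N powr (-5/2)) \<le> exp (real N powr (-5))"
  unfolding cosh_field_def by real_asymp

lemma asymp_moment: "(\<lambda>N. 4 * (real N powr (1/2) / real N + (1 + real N powr (-1/4)) * exp (2 / real N) - 1)) \<longlonglongrightarrow> 0"
  by real_asymp

text \<open>This is the bound of \<open>prob_all_low_le\<close> at \<open>n = N ^ 4\<close>. The
  first summand stems from equal times and is at most \<open>N powr (1/2) / N\<close>; the second
  stems from distinct times and tends to 1, since
  \<open>n * \<theta>\<^sup>2 = 1 / N\<close>.\<close>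

lemma second_moment_tendsto:
  "(\<lambda>N. 4 * ((cosh (2 * tilt N) / (cosh (tilt N))\<^sup>2) ^ (N ^ 4) / real N
    + (1 + real N powr (-1/4)) * cosh (real N powr (-5/2)) ^ (2 * N ^ 4) - 1)) \<longlonglongrightarrow> 0"
proof (rule tendsto_sandwich[OF _ _ tendsto_const asymp_moment])
  let ?f = "\<lambda>N. 4 * ((cosh (2 * tilt N) / (cosh (tilt N))\<^sup>2) ^ (N ^ 4) / real N
    + (1 + real N powr (-1/4)) * cosh (real N powr (-5/2)) ^ (2 * N ^ 4) - 1)"
  show "\<forall>\<^sub>F N in sequentially. 0 \<le> ?f N"
  proof (rule always_eventually, rule allI)
    fix N
    have "1 * 1 \<le> (1 + real N powr (-1/4)) * cosh (real N powr (-5/2)) ^ (2 * N ^ 4)"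
      by (rule mult_mono) (auto intro!: one_le_power cosh_real_ge_1)
    moreover have "0 \<le> (cosh (2 * tilt N) / (cosh (tilt N))\<^sup>2) ^ (N ^ 4) / real N" by simp
    moreover have "0 \<le> 4 * (u + v - 1)" if "1 * 1 \<le> v" "0 \<le> u" for u v :: real using that by simp
    ultimately show "0 \<le> ?f N" by blast
  qed
  show "\<forall>\<^sub>F N in sequentially. ?f N
    \<le> 4 * (real N powr (1/2) / real N + (1 + real N powr (-1/4)) * exp (2 / real N) - 1)"
    using eventually_cosh_tilt_le eventually_cosh_powr_le eventually_gt_at_top[of 0]
  proof eventually_elim
    case (elim N)
    have "cosh (2 * tilt N) / (cosh (tilt N))\<^sup>2 \<le> cosh (2 * tilt N) / 1"
      by (intro divide_left_mono) (simp_all add: one_le_power cosh_real_ge_1)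
    also have "\<dots> \<le> exp (4 * (tilt N)\<^sup>2)" using elim(1) by simp
    finally have "(cosh (2 * tilt N) / (cosh (tilt N))\<^sup>2) ^ (N ^ 4) \<le> exp (4 * (tilt N)\<^sup>2) ^ (N ^ 4)"
      by (rule power_mono) simp
    also have "\<dots> = exp (4 * ((tilt N)\<^sup>2 * real (N ^ 4)))"
      by (simp add: exp_of_nat_mult[symmetric] mult_ac)
    also have "\<dots> = real N powr (1/2)"
      unfolding tilt_square[OF elim(3)] using elim(3) by (simp add: powr_def)
    finally have 1: "(cosh (2 * tilt N) / (cosh (tilt N))\<^sup>2) ^ (N ^ 4) / real N \<le> real N powr (1/2) / real N"
      by (rule divide_right_mono) simp
    have "cosh (real N powr (-5/2)) ^ (2 * N ^ 4) \<le> exp (real N powr (-5)) ^ (2 * N ^ 4)"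
      using elim(2) by (rule power_mono) simp
    also have "\<dots> = exp (2 * (real N ^ 4 * real N powr (-5)))"
      by (simp add: exp_of_nat_mult[symmetric] mult_ac)
    also have "real N ^ 4 * real N powr (-5) = 1 / real N"
      using elim(3) by (simp add: powr_minus powr_numeral field_simps eval_nat_numeral)
    finally have "(1 + real N powr (-1/4)) * cosh (real N powr (-5/2)) ^ (2 * N ^ 4)
      \<le> (1 + real N powr (-1/4)) * exp (2 / real N)"
      by (intro mult_left_mono) auto
    moreover have "4 * (u + v - 1) \<le> 4 * (u' + v' - 1)" if "u \<le> u'" "v \<le> v'" for u u' v v' :: real
      using that by simp
    ultimately show ?case using 1 by blast
  qed
qed

text \<open>With \<open>s\<^sup>2 = ln N\<close> and \<open>n = N ^ 4\<close> one has
  \<open>sqrt (n * ln n) = 2 * s * N ^ 2\<close>. The numerator is at least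
  \<open>s\<^sup>2 / 32 - ln 2\<close>, hence at least \<open>s\<^sup>2 / 64\<close> once
  \<open>N \<ge> exp 64\<close>, and \<open>tilt N \<le> s / (2 * N ^ 2)\<close>. The quotient is
  then at least \<open>s * N ^ 2 / 32\<close>, which is where \<open>1 / 64\<close> comes
  from.\<close>

lemma eventually_height:
  "\<forall>\<^sub>F N in sequentially. 1 / 64 * sqrt (real (N ^ 4) * ln (real (N ^ 4)))
    \<le> (real (N ^ 4) * ln (cosh (tilt N)) - ln 2) / tilt N"
proof -
  have "\<forall>\<^sub>F N in sequentially. real N \<ge> exp 64"
    by (rule eventually_compose_filterlim[OF eventually_ge_at_top filterlim_real_sequentially])
  with eventually_cosh_tilt_ge eventually_gt_at_top[of 1] show ?thesis
  proof eventually_elim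
    case (elim N)
    define s where "s = sqrt (ln (real N))"
    have ln64: "ln (real N) \<ge> 64" using elim by (simp add: ln_ge_iff)
    then have s: "s > 0" "s\<^sup>2 = ln (real N)" by (simp_all add: s_def)
    have tilt: "tilt N > 0" "tilt N \<le> s / (2 * real N ^ 2)"
    proof -
      have "sqrt (ln (real N) / 8) \<le> sqrt (ln (real N) / 4)" using ln64 by simp
      also have "\<dots> = s / 2" by (simp add: s_def real_sqrt_divide)
      finally show "tilt N \<le> s / (2 * real N ^ 2)"
        unfolding tilt_def using divide_right_mono[of _ "s / 2" "real N ^ 2"] by simp
      show "tilt N > 0" using elim ln64 by (simp add: tilt_def)
    qed
    have "ln (real (N ^ 4)) = 4 * s\<^sup>2"
      using elim by (simp add: ln_realpow s)
    then have "sqrt (real (N ^ 4) * ln (real (N ^ 4))) = sqrt ((2 * s * real N ^ 2)\<^sup>2)"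
      by (simp add: power_mult_distrib flip: power_mult)
    also have "\<dots> = 2 * s * real N ^ 2" using s by (subst real_sqrt_abs) simp
    finally have "1 / 64 * sqrt (real (N ^ 4) * ln (real (N ^ 4))) = (s\<^sup>2 / 64) / (s / (2 * real N ^ 2))"
      using s elim by (simp add: power2_eq_square field_simps)
    also have "\<dots> \<le> (s\<^sup>2 / 64) / tilt N"
      using tilt s elim by (intro divide_left_mono) auto
    also have "\<dots> \<le> (real (N ^ 4) * ln (cosh (tilt N)) - ln 2) / tilt N"
    proof (rule divide_right_mono)
      have "(tilt N)\<^sup>2 / 4 = ln (exp ((tilt N)\<^sup>2 / 4))" by simp
      also have "\<dots> \<le> ln (cosh (tilt N))" using elim by (subst ln_le_cancel_iff) auto
      finally have "real (N ^ 4) * ((tilt N)\<^sup>2 / 4) \<le> real (N ^ 4) * ln (cosh (tilt N))"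
        by (rule mult_left_mono) simp
      moreover have "real (N ^ 4) * ((tilt N)\<^sup>2 / 4) = s\<^sup>2 / 32"
        using tilt_square[of N] elim by (simp add: s)
      moreover have "ln 2 \<le> (1 :: real)" using ln_2_less_1 by simp
      ultimately show "s\<^sup>2 / 64 \<le> real (N ^ 4) * ln (cosh (tilt N)) - ln 2"
        using ln64 unfolding s by linarith
    qed (use tilt in simp)
    finally show ?case .
  qed
qed

lemma cosh_half_less_exp_imp_high:
  assumes \<beta>: "\<beta> > 0" and high: "cosh \<beta> ^ n / 2 < exp (\<beta> * x)"
    and height: "h \<le> (real n * ln (cosh \<beta>) - ln 2) / \<beta>"
  shows "h \<le> x"
proof -
  have "real n * ln (cosh \<beta>) - ln 2 = ln (cosh \<beta> ^ n / 2)"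
    by (simp add: ln_div ln_realpow)
  also have "\<dots> < ln (exp (\<beta> * x))"
    by (subst ln_less_cancel_iff) (use high in auto)
  finally have "(real n * ln (cosh \<beta>) - ln 2) / \<beta> < x"
    using \<beta> by (simp add: divide_less_eq mult.commute)
  with height show ?thesis by linarith
qed

section \<open>The dynamical web\<close>

context dynamical_discrete_web
begin

definition source :: "(int \<times> int) \<times> nat + (int \<times> int) \<times> nat \<Rightarrow> 'a \<Rightarrow> real" where
  "source = case_sum (\<lambda>(z, n) \<omega>. real_of_int (mark z n \<omega>)) (\<lambda>(z, n). gap z n)"

lemma source_simps [simp]:
  "source (Inl (z, n)) \<omega> = real_of_int (mark z n \<omega>)" "source (Inr (z, n)) \<omega> = gap z n \<omega>"
  by (simp_all add: source_def)

lemma indep_source: "indep_vars (\<lambda>_. borel) source ((Z2even \<times> UNIV) <+> (Z2even \<times> UNIV))"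
  using independence unfolding source_def .

text \<open>Ring counts depend on the waiting times only, so an arrow becomes a mark read at an
  index independent of the marks.\<close>

definition rings :: "int \<times> int \<Rightarrow> real \<Rightarrow> 'a \<Rightarrow> nat" where
  "rings z \<tau> \<omega> = card {n. ring_time gap z n \<omega> \<le> \<tau>}"

lemma arrow_rings: "arrow mark gap z \<tau> \<omega> = mark z (rings z \<tau> \<omega>) \<omega>"
  by (simp add: arrow_def rings_def)

section \<open>Measurability and joint law of the arrows\<close>

lemma mark_in: "z \<in> Z2even \<Longrightarrow> \<omega> \<in> space M \<Longrightarrow> mark z n \<omega> \<in> {-1, 1}"
  using measurable_space[OF mark_measurable] by fastforce

lemma arrow_in: "z \<in> Z2even \<Longrightarrow> \<omega> \<in> space M \<Longrightarrow> arrow mark gap z \<tau> \<omega> \<in> {-1, 1}"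
  unfolding arrow_rings by (rule mark_in)

lemma measurable_mark: "z \<in> Z2even \<Longrightarrow> mark z n \<in> measurable M (count_space UNIV)"
  using measurable_compose[OF mark_measurable, of z id "count_space UNIV"] by simp

lemma measurable_gap: "z \<in> Z2even \<Longrightarrow> gap z n \<in> borel_measurable M"
  using distributed_measurable[OF gap_exponential] by simp

lemma measurable_rings:
  assumes "z \<in> Z2even" shows "rings z \<tau> \<in> measurable M (count_space UNIV)"
proof -
  note [measurable] = measurable_gap[OF assms]
  show ?thesis unfolding rings_def ring_time_def by measurable
qed

lemma measurable_arrow:
  assumes "z \<in> Z2even" shows "arrow mark gap z \<tau> \<in> measurable M (count_space UNIV)"
  unfolding arrow_rings[abs_def]
  by (rule measurable_compose_countable[OF measurable_mark measurable_rings]) (use assms in auto)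

lemma prob_mark:
  assumes "z \<in> Z2even" "x \<in> {-1, 1}"
  shows "prob {\<omega> \<in> space M. mark z n \<omega> = x} = 1/2"
proof -
  have "prob {\<omega> \<in> space M. mark z n \<omega> = x} = measure (distr M (count_space {-1, 1}) (mark z n)) {x}"
    using assms mark_measurable[OF assms(1), of n] by (subst measure_distr) (auto intro!: arg_cong[where f=prob])
  also have "\<dots> = 1/2"
    using assms(2) unfolding mark_uniform[OF assms(1)] by (subst measure_uniform_count_measure) auto
  finally show ?thesis .
qed

lemma prob_mark_mark:
  assumes "z \<in> Z2even" "x \<in> {-1, 1}" "y \<in> {-1, 1}"
  shows "prob {\<omega> \<in> space M. mark z k \<omega> = x \<and> mark z l \<omega> = y} = (if k = l then if x = y then 1/2 else 0 else 1/4)"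
proof (cases "k = l")
  case True
  have "{\<omega> \<in> space M. mark z l \<omega> = x \<and> mark z l \<omega> = y} = (if x = y then {\<omega> \<in> space M. mark z l \<omega> = x} else {})"
    by auto
  then show ?thesis unfolding True using prob_mark[OF assms(1,2)] prob_mark[OF assms(1,3)] by simp
next
  case False
  let ?A = "\<lambda>i. if i = Inl (z, k) then {real_of_int x} else {real_of_int y}"
  have "prob (\<Inter>i\<in>{Inl (z, k), Inl (z, l)}. source i -` ?A i \<inter> space M)
      = (\<Prod>i\<in>{Inl (z, k), Inl (z, l)}. prob (source i -` ?A i \<inter> space M))"
    by (rule indep_varsD[OF indep_source]) (use assms in auto)
  also have "\<dots> = prob (source (Inl (z, k)) -` {real_of_int x} \<inter> space M) * prob (source (Inl (z, l)) -` {real_of_int y} \<inter> space M)"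
    using False by simp
  also have "source (Inl (z, k)) -` {real_of_int x} \<inter> space M = {\<omega> \<in> space M. mark z k \<omega> = x}" by auto
  also have "source (Inl (z, l)) -` {real_of_int y} \<inter> space M = {\<omega> \<in> space M. mark z l \<omega> = y}" by auto
  also have "(\<Inter>i\<in>{Inl (z, k), Inl (z, l)}. source i -` ?A i \<inter> space M) = {\<omega> \<in> space M. mark z k \<omega> = x \<and> mark z l \<omega> = y}"
    using False by auto
  finally show ?thesis using False prob_mark[OF assms(1,2)] prob_mark[OF assms(1,3)] by simp
qed

text \<open>The marks and the waiting times at \<open>z\<close> are disjoint blocks of one
  independent family, and the ring counts are functions of the waiting times.\<close>

lemma prob_mark_mark_rings:
  assumes z: "z \<in> Z2even"
  shows "prob {\<omega> \<in> space M. (mark z k \<omega> = x \<and> mark z l \<omega> = y) \<and> (rings z \<tau> \<omega>, rings z \<tau>' \<omega>) = i}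
    = prob {\<omega> \<in> space M. mark z k \<omega> = x \<and> mark z l \<omega> = y} * prob {\<omega> \<in> space M. (rings z \<tau> \<omega>, rings z \<tau>' \<omega>) = i}"
proof -
  let ?A = "range (\<lambda>n::nat. Inl (z, n)) :: ((int \<times> int) \<times> nat + (int \<times> int) \<times> nat) set"
  let ?B = "range (\<lambda>n::nat. Inr (z, n)) :: ((int \<times> int) \<times> nat + (int \<times> int) \<times> nat) set"
  \<comment> \<open>\<open>f\<close> recovers the marks from their real embedding by the floor;
    \<open>g\<close> casts the counts to \<open>int\<close>, since \<open>indep_var\<close> needs
    one value type for both.\<close>
  define f where "f v = (\<lfloor>v (Inl (z, k))\<rfloor>, \<lfloor>v (Inl (z, l))\<rfloor>)"
    for v :: "((int \<times> int) \<times> nat + (int \<times> int) \<times> nat) \<Rightarrow> real"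
  define g where "g v = (int (card {n. (\<Sum>j\<le>n. v (Inr (z, j))) \<le> \<tau>}), int (card {n. (\<Sum>j\<le>n. v (Inr (z, j))) \<le> \<tau>'}))"
    for v :: "((int \<times> int) \<times> nat + (int \<times> int) \<times> nat) \<Rightarrow> real"
  have ind: "indep_var (PiM ?A (\<lambda>_. borel)) (\<lambda>\<omega>. restrict (\<lambda>i. source i \<omega>) ?A)
      (PiM ?B (\<lambda>_. borel)) (\<lambda>\<omega>. restrict (\<lambda>i. source i \<omega>) ?B)"
    by (rule indep_var_restrict[OF indep_source]) (use z in auto)
  have comp: "(\<lambda>v. v i) \<in> borel_measurable (PiM K (\<lambda>_. borel))" if "i \<in> K"
    for i :: "(int \<times> int) \<times> nat + (int \<times> int) \<times> nat" and K
    using that by measurable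
  have cl [measurable]: "(\<lambda>v. v (Inl (z, n))) \<in> borel_measurable (PiM ?A (\<lambda>_. borel))" for n by (rule comp) auto
  have cr [measurable]: "(\<lambda>v. v (Inr (z, n))) \<in> borel_measurable (PiM ?B (\<lambda>_. borel))" for n by (rule comp) auto
  have f: "f \<in> measurable (PiM ?A (\<lambda>_. borel)) (count_space UNIV)"
    unfolding f_def by measurable
  have g: "g \<in> measurable (PiM ?B (\<lambda>_. borel)) (count_space UNIV)"
    unfolding g_def by measurable
  have 1: "f (restrict (\<lambda>i. source i \<omega>) ?A) = (mark z k \<omega>, mark z l \<omega>)" for \<omega>
    by (simp add: f_def)
  have 2: "g (restrict (\<lambda>i. source i \<omega>) ?B) = (int (rings z \<tau> \<omega>), int (rings z \<tau>' \<omega>))" for \<omega>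
    by (simp add: g_def rings_def ring_time_def)
  from indep_varD[OF indep_var_compose[OF ind f g], of "{(x, y)}" "{(int (fst i), int (snd i))}"] show ?thesis
    by (cases i) (simp add: comp_def 1 2 vimage_def Int_def conj_commute conj_ac)
qed

text \<open>By \<open>prob_arrow_arrow\<close> this is the correlation of the arrows at
  \<open>z\<close> at the two dynamical times.\<close>

definition stay :: "int \<times> int \<Rightarrow> real \<Rightarrow> real \<Rightarrow> real" where
  "stay z \<tau> \<tau>' = prob {\<omega> \<in> space M. rings z \<tau> \<omega> = rings z \<tau>' \<omega>}"

text \<open>Condition on the pair of ring counts. Equal counts read the same uniform mark, which
  gives 1/2 or 0; different counts read two independent marks, which gives 1/4.\<close>

lemma prob_arrow_arrow:
  assumes z: "z \<in> Z2even" and xy: "x \<in> {-1, 1}" "y \<in> {-1, 1}"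
  shows "prob {\<omega> \<in> space M. arrow mark gap z \<tau> \<omega> = x \<and> arrow mark gap z \<tau>' \<omega> = y} = (1 + stay z \<tau> \<tau>' * real_of_int (x * y)) / 4"
proof -
  note [measurable] = measurable_mark[OF z] measurable_rings[OF z]
  define W where "W \<omega> = (rings z \<tau> \<omega>, rings z \<tau>' \<omega>)" for \<omega>
  have W [measurable]: "W \<in> measurable M (count_space UNIV)" unfolding W_def by measurable
  let ?E = "\<lambda>i \<omega>. mark z (fst i) \<omega> = x \<and> mark z (snd i) \<omega> = y"
  have E [measurable]: "Measurable.pred M (?E i)" for i by measurable
  define D where "D = {i::nat \<times> nat. fst i = snd i}"
  have D: "prob {\<omega> \<in> space M. W \<omega> \<in> D} = stay z \<tau> \<tau>'" by (simp add: D_def W_def stay_def)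
  have "{\<omega> \<in> space M. W \<omega> \<in> - D} = space M - {\<omega> \<in> space M. W \<omega> \<in> D}" by auto
  then have D': "prob {\<omega> \<in> space M. W \<omega> \<in> - D} = 1 - stay z \<tau> \<tau>'"
    using prob_compl[of "{\<omega> \<in> space M. W \<omega> \<in> D}"] D by simp
  have ind: "prob {\<omega> \<in> space M. ?E i \<omega> \<and> W \<omega> = i} = prob {\<omega> \<in> space M. ?E i \<omega>} * prob {\<omega> \<in> space M. W \<omega> = i}" for i
    using prob_mark_mark_rings[OF z] by (simp add: W_def)
  have 1: "prob {\<omega> \<in> space M. ?E (W \<omega>) \<omega> \<and> W \<omega> \<in> D} = (if x = y then 1/2 else 0) * prob {\<omega> \<in> space M. W \<omega> \<in> D}"
    proof (rule prob_at_random_index[OF W E])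
    fix i assume "i \<in> D"
    then show "prob {\<omega> \<in> space M. ?E i \<omega> \<and> W \<omega> = i} = (if x = y then 1/2 else 0) * prob {\<omega> \<in> space M. W \<omega> = i}"
      unfolding ind prob_mark_mark[OF z xy] by (simp add: D_def)
  qed simp
  have 2: "prob {\<omega> \<in> space M. ?E (W \<omega>) \<omega> \<and> W \<omega> \<in> - D} = 1/4 * prob {\<omega> \<in> space M. W \<omega> \<in> - D}"
    proof (rule prob_at_random_index[OF W E])
    fix i assume "i \<in> - D"
    then show "prob {\<omega> \<in> space M. ?E i \<omega> \<and> W \<omega> = i} = 1/4 * prob {\<omega> \<in> space M. W \<omega> = i}"
      unfolding ind prob_mark_mark[OF z xy] by (simp add: D_def)
  qed simp
  have [measurable]: "Measurable.pred M (\<lambda>\<omega>. ?E (W \<omega>) \<omega>)"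
    by (rule measurable_compose_countable[OF E W])
  have "{\<omega> \<in> space M. arrow mark gap z \<tau> \<omega> = x \<and> arrow mark gap z \<tau>' \<omega> = y}
      = {\<omega> \<in> space M. ?E (W \<omega>) \<omega> \<and> W \<omega> \<in> D} \<union> {\<omega> \<in> space M. ?E (W \<omega>) \<omega> \<and> W \<omega> \<in> - D}"
    by (auto simp: arrow_rings W_def)
  also have "prob \<dots> = prob {\<omega> \<in> space M. ?E (W \<omega>) \<omega> \<and> W \<omega> \<in> D} + prob {\<omega> \<in> space M. ?E (W \<omega>) \<omega> \<and> W \<omega> \<in> - D}"
    by (rule finite_measure_Union) auto
  also have "\<dots> = (1 + stay z \<tau> \<tau>' * real_of_int (x * y)) / 4"
    unfolding 1 2 D D' using xy by (auto simp: field_simps)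
  finally show ?thesis .
qed

text \<open>Pairs are taken because two paths at different dynamical times may read the same site.
  The pair at \<open>z\<close> is a function of the marks and waiting times at \<open>z\<close>, and
  these blocks are disjoint.\<close>

lemma indep_arrow_pairs:
  "indep_vars (\<lambda>_. count_space UNIV) (\<lambda>z \<omega>. (arrow mark gap z \<tau> \<omega>, arrow mark gap z \<tau>' \<omega>)) Z2even"
proof -
  define K :: "int \<times> int \<Rightarrow> ((int \<times> int) \<times> nat + (int \<times> int) \<times> nat) set"
    where "K z = range (\<lambda>n. Inl (z, n)) \<union> range (\<lambda>n. Inr (z, n))" for z
  define r where "r \<tau> z v = card {n. (\<Sum>j\<le>n. v (Inr (z, j))) \<le> \<tau>}"
    for \<tau> z and v :: "((int \<times> int) \<times> nat + (int \<times> int) \<times> nat) \<Rightarrow> real"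
  define f where "f \<tau> z v = \<lfloor>v (Inl (z, r \<tau> z v))\<rfloor>"
    for \<tau> z and v :: "((int \<times> int) \<times> nat + (int \<times> int) \<times> nat) \<Rightarrow> real"
  have comp: "(\<lambda>v. v i) \<in> borel_measurable (PiM K (\<lambda>_. borel))" if "i \<in> K"
    for i :: "(int \<times> int) \<times> nat + (int \<times> int) \<times> nat" and K
    using that by measurable
  have [measurable]: "(\<lambda>v. v (Inl (z, n))) \<in> borel_measurable (PiM (K z) (\<lambda>_. borel))"
    "(\<lambda>v. v (Inr (z, n))) \<in> borel_measurable (PiM (K z) (\<lambda>_. borel))" for z n
    by (rule comp; simp add: K_def)+
  have [measurable]: "r \<tau> z \<in> measurable (PiM (K z) (\<lambda>_. borel)) (count_space UNIV)" for \<tau> z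
    unfolding r_def by measurable
  have [measurable]: "f \<tau> z \<in> measurable (PiM (K z) (\<lambda>_. borel)) (count_space UNIV)" for \<tau> z
  proof -
    have "(\<lambda>v. (\<lambda>n v. \<lfloor>v (Inl (z, n))\<rfloor>) (r \<tau> z v) v) \<in> measurable (PiM (K z) (\<lambda>_. borel)) (count_space UNIV)"
      by (rule measurable_compose_countable) measurable
    then show ?thesis by (simp add: f_def[abs_def])
  qed
  have "indep_vars (\<lambda>z. PiM (K z) (\<lambda>_. borel)) (\<lambda>z \<omega>. restrict (\<lambda>i. source i \<omega>) (K z)) Z2even"
    by (rule indep_vars_restrict[OF indep_source]) (auto simp: K_def disjoint_family_on_def)
  then have "indep_vars (\<lambda>_. count_space UNIV)
      (\<lambda>z \<omega>. (\<lambda>v. (f \<tau> z v, f \<tau>' z v)) (restrict (\<lambda>i. source i \<omega>) (K z))) Z2even"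
    by (rule indep_vars_compose2) measurable
  moreover have "f \<tau> z (restrict (\<lambda>i. source i \<omega>) (K z)) = arrow mark gap z \<tau> \<omega>" for \<tau> z \<omega>
    by (simp add: f_def r_def K_def arrow_def ring_time_def)
  ultimately show ?thesis by simp
qed

lemma prob_arrow:
  assumes "z \<in> Z2even" "x \<in> {-1, 1}"
  shows "prob {\<omega> \<in> space M. arrow mark gap z \<tau> \<omega> = x} = 1/2"
  using prob_arrow_arrow[OF assms(1) assms(2) assms(2), of \<tau> \<tau>] assms(2)
  by (auto simp: stay_def prob_space)

definition corr :: "int \<times> int \<Rightarrow> int \<times> int \<Rightarrow> real \<Rightarrow> real \<Rightarrow> real" where
  "corr z z' \<tau> \<tau>' = (if z = z' then stay z \<tau> \<tau>' else 0)"

lemma prob_arrows: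
  assumes z: "z \<in> Z2even" "z' \<in> Z2even" and xy: "x \<in> {-1, 1}" "y \<in> {-1, 1}"
  shows "prob {\<omega> \<in> space M. arrow mark gap z \<tau> \<omega> = x \<and> arrow mark gap z' \<tau>' \<omega> = y}
    = (1 + corr z z' \<tau> \<tau>' * real_of_int (x * y)) / 4"
proof (cases "z = z'")
  case True
  then show ?thesis using prob_arrow_arrow[OF z(1) xy] by (simp add: corr_def)
next
  case False
  let ?P = "\<lambda>z \<omega>. (arrow mark gap z \<tau> \<omega>, arrow mark gap z \<tau>' \<omega>)"
  let ?A = "\<lambda>i. if i = z then {x} \<times> UNIV else UNIV \<times> {y}"
  have "prob (\<Inter>i\<in>{z, z'}. ?P i -` ?A i \<inter> space M) = (\<Prod>i\<in>{z, z'}. prob (?P i -` ?A i \<inter> space M))"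
    by (rule indep_varsD[OF indep_arrow_pairs]) (use z in auto)
  also have "\<dots> = prob (?P z -` ({x} \<times> UNIV) \<inter> space M) * prob (?P z' -` (UNIV \<times> {y}) \<inter> space M)"
    using False by simp
  also have "?P z -` ({x} \<times> UNIV) \<inter> space M = {\<omega> \<in> space M. arrow mark gap z \<tau> \<omega> = x}" by auto
  also have "?P z' -` (UNIV \<times> {y}) \<inter> space M = {\<omega> \<in> space M. arrow mark gap z' \<tau>' \<omega> = y}" by auto
  also have "(\<Inter>i\<in>{z, z'}. ?P i -` ?A i \<inter> space M) =
      {\<omega> \<in> space M. arrow mark gap z \<tau> \<omega> = x \<and> arrow mark gap z' \<tau>' \<omega> = y}"
    using False by auto
  finally show ?thesis using False prob_arrow[OF z(1) xy(1)] prob_arrow[OF z(2) xy(2)] by (simp add: corr_def)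
qed

section \<open>Paths from the origin and the pair chain\<close>

definition pos :: "real \<Rightarrow> nat \<Rightarrow> 'a \<Rightarrow> int" where
  "pos \<tau> n \<omega> = walk (\<lambda>z. arrow mark gap z \<tau> \<omega>) n"

lemma pos_0 [simp]: "pos \<tau> 0 \<omega> = 0"
  by (simp add: pos_def)

lemma pos_Suc: "pos \<tau> (Suc n) \<omega> = pos \<tau> n \<omega> + arrow mark gap (pos \<tau> n \<omega>, int n) \<tau> \<omega>"
  by (simp add: pos_def)

lemma pos_in: "\<omega> \<in> space M \<Longrightarrow> (pos \<tau> n \<omega>, int n) \<in> Z2even \<and> \<bar>pos \<tau> n \<omega>\<bar> \<le> int n"
  unfolding pos_def by (rule walk_bound) (rule arrow_in)

lemma measurable_pos: "pos \<tau> n \<in> measurable M (count_space UNIV)"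
proof -
  \<comment> \<open>Nothing is assumed about arrows off the even sites, so they are set to 0 there;
    the path never visits such sites.\<close>
  let ?v = "\<lambda>\<omega> z. if z \<in> Z2even then arrow mark gap z \<tau> \<omega> else 0"
  have "(\<lambda>\<omega>. walk (?v \<omega>) n) \<in> measurable M (count_space UNIV)"
  proof (rule measurable_walk)
    show "(\<lambda>\<omega>. ?v \<omega> z) \<in> measurable M (count_space UNIV)" for z
      using measurable_arrow[of z] by (cases "z \<in> Z2even") auto
  qed
  moreover have "walk (?v \<omega>) n = pos \<tau> n \<omega>" if "\<omega> \<in> space M" for \<omega>
    unfolding pos_def by (rule walk_cong[where n = n]) (use arrow_in that in \<open>auto simp: light_cone_def\<close>)
  ultimately show ?thesis by (simp cong: measurable_cong)
qed

text \<open>Markov property of the pair: the positions at time \<open>n\<close> are functions of the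
  arrows at earlier times, whereas the new arrows sit at time \<open>n\<close>.\<close>

lemma prob_pos_arrow:
  assumes z: "(x, int n) \<in> Z2even" "(y, int n) \<in> Z2even"
  shows "prob {\<omega> \<in> space M. (pos \<tau> n \<omega> = x \<and> pos \<tau>' n \<omega> = y) \<and>
        (arrow mark gap (x, int n) \<tau> \<omega> = e \<and> arrow mark gap (y, int n) \<tau>' \<omega> = e')}
    = prob {\<omega> \<in> space M. pos \<tau> n \<omega> = x \<and> pos \<tau>' n \<omega> = y} *
      prob {\<omega> \<in> space M. arrow mark gap (x, int n) \<tau> \<omega> = e \<and> arrow mark gap (y, int n) \<tau>' \<omega> = e'}"
proof -
  let ?A = "{z \<in> Z2even. snd z < int n}" and ?B = "{z \<in> Z2even. snd z = int n}"
  let ?P = "\<lambda>z \<omega>. (arrow mark gap z \<tau> \<omega>, arrow mark gap z \<tau>' \<omega>)"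
  define f where "f v = (walk (\<lambda>z. if z \<in> ?A then fst (v z) else 0) n, walk (\<lambda>z. if z \<in> ?A then snd (v z) else 0) n)"
    for v :: "int \<times> int \<Rightarrow> int \<times> int"
  obtain z1 z2 where z12: "z1 = (x, int n)" "z2 = (y, int n)" by blast
  define g where "g v = (fst (v z1), snd (v z2))" for v :: "int \<times> int \<Rightarrow> int \<times> int"
  have ind: "indep_var (PiM ?A (\<lambda>_. count_space UNIV)) (\<lambda>\<omega>. restrict (\<lambda>z. ?P z \<omega>) ?A)
      (PiM ?B (\<lambda>_. count_space UNIV)) (\<lambda>\<omega>. restrict (\<lambda>z. ?P z \<omega>) ?B)"
    by (rule indep_var_restrict[OF indep_arrow_pairs]) auto
  have comp: "(\<lambda>v. v z) \<in> measurable (PiM K (\<lambda>_. count_space UNIV)) (count_space UNIV)" if "z \<in> K"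
    for z :: "int \<times> int" and K
    using that by measurable
  have f1: "(\<lambda>v. if z \<in> ?A then h (v z) else 0) \<in> measurable (PiM ?A (\<lambda>_. count_space UNIV)) (count_space UNIV)"
    for z and h :: "int \<times> int \<Rightarrow> int"
    using measurable_compose[OF comp[of z ?A], of h "count_space UNIV"] by (cases "z \<in> ?A") auto
  have [measurable]: "(\<lambda>v. walk (\<lambda>z. if z \<in> ?A then h (v z) else 0) n)
      \<in> measurable (PiM ?A (\<lambda>_. count_space UNIV)) (count_space UNIV)" for h :: "int \<times> int \<Rightarrow> int"
    by (rule measurable_walk[OF f1])
  have f: "f \<in> measurable (PiM ?A (\<lambda>_. count_space UNIV)) (count_space UNIV)"
    unfolding f_def by measurable
  have "(\<lambda>v. v z1) \<in> measurable (PiM ?B (\<lambda>_. count_space UNIV)) (count_space UNIV)"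
    "(\<lambda>v. v z2) \<in> measurable (PiM ?B (\<lambda>_. count_space UNIV)) (count_space UNIV)"
    by (rule comp; use z in \<open>simp add: z12\<close>)+
  from this[THEN measurable_compose, of _ "count_space UNIV"]
  have [measurable]: "(\<lambda>v. fst (v z1)) \<in> measurable (PiM ?B (\<lambda>_. count_space UNIV)) (count_space UNIV)"
    "(\<lambda>v. snd (v z2)) \<in> measurable (PiM ?B (\<lambda>_. count_space UNIV)) (count_space UNIV)"
    by simp_all
  have g: "g \<in> measurable (PiM ?B (\<lambda>_. count_space UNIV)) (count_space UNIV)"
    unfolding g_def by measurable
  have 1: "f (restrict (\<lambda>z. ?P z \<omega>) ?A) = (pos \<tau> n \<omega>, pos \<tau>' n \<omega>)" if "\<omega> \<in> space M" for \<omega>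
    unfolding f_def pos_def prod.inject
    by (intro conjI; rule walk_cong[where n = n]) (use arrow_in that in \<open>auto simp: light_cone_def\<close>)
  have 2: "g (restrict (\<lambda>z. ?P z \<omega>) ?B)
      = (arrow mark gap (x, int n) \<tau> \<omega>, arrow mark gap (y, int n) \<tau>' \<omega>)" for \<omega>
    using z by (simp add: g_def z12)
  show ?thesis
    using indep_varD[OF indep_var_compose[OF ind f g], of "{(x, y)}" "{(e, e')}"]
    by (simp add: comp_def 1 2 vimage_def Int_def conj_commute conj_ac cong: conj_cong)
qed

text \<open>Given the current pair of positions, the sum in \<open>step\<close> is the mean of
  \<open>w\<close> after the next arrows. Both \<open>w\<close> and \<open>- w\<close> are
  admissible, which turns one-step identities into equalities of expectations.\<close>

lemma expectation_step_le:
  fixes w :: "int \<Rightarrow> int \<Rightarrow> real"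
  assumes step: "\<And>x y. (x, int n) \<in> Z2even \<Longrightarrow> (y, int n) \<in> Z2even \<Longrightarrow>
    (\<Sum>(e, e')\<in>{-1, 1} \<times> {-1, 1}. (1 + corr (x, int n) (y, int n) \<tau> \<tau>' * real_of_int (e * e')) / 4 * w (x + e) (y + e'))
      \<le> \<kappa> * w x y"
  shows "expectation (\<lambda>\<omega>. w (pos \<tau> (Suc n) \<omega>) (pos \<tau>' (Suc n) \<omega>))
    \<le> \<kappa> * expectation (\<lambda>\<omega>. w (pos \<tau> n \<omega>) (pos \<tau>' n \<omega>))"
proof -
  note [measurable] = measurable_pos
  define Q where "Q = {x. \<bar>x\<bar> \<le> int n \<and> (x, int n) \<in> Z2even}"
  have fin: "finite Q" by (rule finite_subset[of _ "{-int n..int n}"]) (auto simp: Q_def)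
  let ?E = "{-1, 1} \<times> {-1, 1} :: (int \<times> int) set"
  \<comment> \<open>\<open>F\<close> keeps the present pair and its next increments; as it has
    finitely many values, the expectation becomes a finite sum.\<close>
  define F where "F \<omega> = ((pos \<tau> n \<omega>, pos \<tau>' n \<omega>),
    (pos \<tau> (Suc n) \<omega> - pos \<tau> n \<omega>, pos \<tau>' (Suc n) \<omega> - pos \<tau>' n \<omega>))" for \<omega>
  have F [measurable]: "F \<in> measurable M (count_space UNIV)" unfolding F_def by measurable
  have pos_Q: "pos \<tau> n \<omega> \<in> Q" if "\<omega> \<in> space M" for \<tau> \<omega> using pos_in[OF that] by (auto simp: Q_def)
  have "F \<omega> \<in> (Q \<times> Q) \<times> ?E" if "\<omega> \<in> space M" for \<omega>
    using pos_Q[OF that, of \<tau>] pos_Q[OF that, of \<tau>'] arrow_in[OF conjunct1[OF pos_in[OF that]] that, of \<tau> n \<tau>]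
      arrow_in[OF conjunct1[OF pos_in[OF that]] that, of \<tau>' n \<tau>'] unfolding F_def pos_Suc by simp blast
  from expectation_finite_values(2)[OF F _ this, where h = "\<lambda>((x, y), (e, e')). w (x + e) (y + e')"] fin
  have "expectation (\<lambda>\<omega>. w (pos \<tau> (Suc n) \<omega>) (pos \<tau>' (Suc n) \<omega>))
    = (\<Sum>(p, q)\<in>(Q \<times> Q) \<times> ?E. prob {\<omega> \<in> space M. F \<omega> = (p, q)} * w (fst p + fst q) (snd p + snd q))"
    by (simp add: F_def case_prod_unfold prod_eq_iff)
  also have "\<dots> = (\<Sum>p\<in>Q \<times> Q. \<Sum>q\<in>?E. prob {\<omega> \<in> space M. F \<omega> = (p, q)} * w (fst p + fst q) (snd p + snd q))"
    by (rule sum.cartesian_product[symmetric])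
  also have "\<dots> \<le> (\<Sum>p\<in>Q \<times> Q. prob {\<omega> \<in> space M. (pos \<tau> n \<omega>, pos \<tau>' n \<omega>) = p} * (\<kappa> * w (fst p) (snd p)))"
  proof (rule sum_mono)
    fix p assume "p \<in> Q \<times> Q"
    then obtain x y where p: "p = (x, y)" and z: "(x, int n) \<in> Z2even" "(y, int n) \<in> Z2even"
      by (auto simp: Q_def)
    let ?p = "prob {\<omega> \<in> space M. (pos \<tau> n \<omega>, pos \<tau>' n \<omega>) = p}"
    let ?c = "corr (x, int n) (y, int n) \<tau> \<tau>'"
    have "prob {\<omega> \<in> space M. F \<omega> = (p, (e, e'))} = ?p * ((1 + ?c * real_of_int (e * e')) / 4)"
      if "e \<in> {-1, 1}" "e' \<in> {-1, 1}" for e e'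
    proof -
      have "{\<omega> \<in> space M. F \<omega> = (p, (e, e'))} = {\<omega> \<in> space M. (pos \<tau> n \<omega> = x \<and> pos \<tau>' n \<omega> = y) \<and>
        (arrow mark gap (x, int n) \<tau> \<omega> = e \<and> arrow mark gap (y, int n) \<tau>' \<omega> = e')}"
        by (auto simp: F_def p pos_Suc)
      then show ?thesis
        using prob_pos_arrow[OF z] prob_arrows[OF z that] by (simp add: p)
    qed
    then have "(\<Sum>q\<in>?E. prob {\<omega> \<in> space M. F \<omega> = (p, q)} * w (fst p + fst q) (snd p + snd q))
      = (\<Sum>(e, e')\<in>?E. ?p * ((1 + ?c * real_of_int (e * e')) / 4 * w (x + e) (y + e')))"
      by (intro sum.cong) (auto simp: p)
    also have "\<dots> = ?p * (\<Sum>(e, e')\<in>?E. (1 + ?c * real_of_int (e * e')) / 4 * w (x + e) (y + e'))"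
      by (simp add: sum_distrib_left case_prod_unfold distrib_left)
    also have "\<dots> \<le> ?p * (\<kappa> * w x y)"
      by (intro mult_left_mono step z measure_nonneg)
    finally show "(\<Sum>q\<in>?E. prob {\<omega> \<in> space M. F \<omega> = (p, q)} * w (fst p + fst q) (snd p + snd q))
      \<le> ?p * (\<kappa> * w (fst p) (snd p))" by (simp add: p)
  qed
  also have "\<dots> = expectation (\<lambda>\<omega>. \<kappa> * w (pos \<tau> n \<omega>) (pos \<tau>' n \<omega>))"
    using expectation_finite_values(2)[of "\<lambda>\<omega>. (pos \<tau> n \<omega>, pos \<tau>' n \<omega>)" "Q \<times> Q" "\<lambda>(x, y). \<kappa> * w x y"] fin pos_Q
    by (simp add: case_prod_unfold)
  also have "\<dots> = \<kappa> * expectation (\<lambda>\<omega>. w (pos \<tau> n \<omega>) (pos \<tau>' n \<omega>))" by simp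
  finally show ?thesis .
qed

lemma expectation_le_power:
  fixes w :: "int \<Rightarrow> int \<Rightarrow> real"
  assumes "\<And>n x y. (x, int n) \<in> Z2even \<Longrightarrow> (y, int n) \<in> Z2even \<Longrightarrow>
    (\<Sum>(e, e')\<in>{-1, 1} \<times> {-1, 1}. (1 + corr (x, int n) (y, int n) \<tau> \<tau>' * real_of_int (e * e')) / 4 * w (x + e) (y + e'))
      \<le> \<kappa> * w x y" and "0 \<le> \<kappa>"
  shows "expectation (\<lambda>\<omega>. w (pos \<tau> n \<omega>) (pos \<tau>' n \<omega>)) \<le> \<kappa> ^ n * w 0 0"
proof (induction n)
  case 0 then show ?case by (simp add: prob_space)
next
  case (Suc n)
  have "expectation (\<lambda>\<omega>. w (pos \<tau> (Suc n) \<omega>) (pos \<tau>' (Suc n) \<omega>))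
    \<le> \<kappa> * expectation (\<lambda>\<omega>. w (pos \<tau> n \<omega>) (pos \<tau>' n \<omega>))"
    by (rule expectation_step_le) (rule assms)
  also have "\<dots> \<le> \<kappa> * (\<kappa> ^ n * w 0 0)"
    by (rule mult_left_mono[OF Suc assms(2)])
  finally show ?case by (simp add: mult.assoc)
qed

section \<open>Ring times and decorrelation of an arrow\<close>

text \<open>Positive waiting times, one of which exceeds 1, leave finitely many rings in
  \<open>[0, 1]\<close>. The first \<open>n\<close> waiting times, being independent, are all at
  most 1 with probability \<open>c ^ n\<close>, which tends to 0.\<close>

lemma AE_gaps:
  assumes z: "z \<in> Z2even"
  shows "AE \<omega> in M. (\<forall>n. gap z n \<omega> > 0) \<and> (\<exists>n. gap z n \<omega> > 1)"
proof -
  note [measurable] = measurable_gap[OF z]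
  have "AE \<omega> in M. gap z n \<omega> > 0" for n
  proof -
    have "prob {\<omega> \<in> space M. gap z n \<omega> > 0} = 1"
      using exponential_distributedD_gt[OF gap_exponential[OF z]] by simp
    then show ?thesis using prob_Collect_eq_1[of "\<lambda>\<omega>. gap z n \<omega> > 0"] by simp
  qed
  moreover have "AE \<omega> in M. \<exists>n. gap z n \<omega> > 1"
  proof -
    define c :: real where "c = 1 - exp (-1)"
    have c: "0 \<le> c" "c < 1" by (simp_all add: c_def)
    have "prob {\<omega> \<in> space M. \<forall>n. gap z n \<omega> \<le> 1} \<le> c ^ n" if n: "n > 0" for n
    proof -
      let ?J = "(\<lambda>k. Inr (z, k)) ` {..<n} :: ((int \<times> int) \<times> nat + (int \<times> int) \<times> nat) set"
      have "{\<omega> \<in> space M. \<forall>n. gap z n \<omega> \<le> 1} \<subseteq> (\<Inter>i\<in>?J. source i -` {..1} \<inter> space M)"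
        by auto
      then have "prob {\<omega> \<in> space M. \<forall>n. gap z n \<omega> \<le> 1} \<le> prob (\<Inter>i\<in>?J. source i -` {..1} \<inter> space M)"
        using n indep_source z
        by (intro finite_measure_mono sets.finite_INT measurable_sets) (auto simp: indep_vars_def)
      also have "\<dots> = (\<Prod>i\<in>?J. prob (source i -` {..1} \<inter> space M))"
        by (rule indep_varsD[OF indep_source]) (use n z in auto)
      also have "\<dots> = (\<Prod>k<n. prob {\<omega> \<in> space M. gap z k \<omega> \<le> 1})"
        by (subst prod.reindex) (auto simp: inj_on_def vimage_def Int_def conj_commute)
      also have "\<dots> = c ^ n"
        using exponential_distributedD_le[OF gap_exponential[OF z]] by (simp add: c_def)
      finally show ?thesis .
    qed
    moreover have "(\<lambda>n. c ^ n) \<longlonglongrightarrow> 0" using c by (rule LIMSEQ_realpow_zero)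
    ultimately have "prob {\<omega> \<in> space M. \<forall>n. gap z n \<omega> \<le> 1} \<le> 0"
      by (intro LIMSEQ_le_const[of "\<lambda>n. c ^ n"]) (auto intro!: exI[of _ 1])
    then have "prob {\<omega> \<in> space M. \<forall>n. gap z n \<omega> \<le> 1} = 0"
      using measure_nonneg by (rule antisym)
    then have "AE \<omega> in M. \<not> (\<forall>n. gap z n \<omega> \<le> 1)"
      by (subst (asm) prob_Collect_eq_0) auto
    then show ?thesis by (simp add: not_le)
  qed
  ultimately show ?thesis by (simp add: AE_all_countable)
qed

lemma finite_ring_times:
  assumes "\<forall>n. gap z n \<omega> > 0" "\<exists>n. gap z n \<omega> > 1"
  shows "finite {n. ring_time gap z n \<omega> \<le> 1}"
proof -
  obtain m where m: "gap z m \<omega> > 1" using assms by blast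
  have "n < m" if "ring_time gap z n \<omega> \<le> 1" for n
  proof (rule ccontr)
    assume "\<not> n < m"
    then have "gap z m \<omega> \<le> (\<Sum>k\<le>n. gap z k \<omega>)"
      using assms(1) by (intro member_le_sum) (auto intro: less_imp_le)
    then show False using m that by (simp add: ring_time_def)
  qed
  then have "{n. ring_time gap z n \<omega> \<le> 1} \<subseteq> {..<m}" by blast
  then show ?thesis by (rule finite_subset) simp
qed

text \<open>If the first ring falls between \<open>\<tau>\<close> and \<open>\<tau>'\<close>, the
  counts differ. This has probability \<open>exp (- \<tau>) - exp (- \<tau>')\<close>, and
  \<open>exp (- \<tau>') \<ge> 1 / 3\<close> since \<open>\<tau>' \<le> 1\<close>.\<close>

lemma stay_le:
  assumes z: "z \<in> Z2even" and \<tau>: "0 \<le> \<tau>" "\<tau> \<le> \<tau>'" "\<tau>' \<le> 1"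
  shows "stay z \<tau> \<tau>' \<le> 1 - (\<tau>' - \<tau>) / 3"
proof -
  note [measurable] = measurable_gap[OF z] measurable_rings[OF z]
  have stay_sets: "{\<omega> \<in> space M. rings z \<tau> \<omega> = rings z \<tau>' \<omega>} \<in> sets M"
  proof -
    have "(\<lambda>\<omega>. (rings z \<tau> \<omega>, rings z \<tau>' \<omega>)) \<in> measurable M (count_space UNIV)" by measurable
    from measurable_sets[OF this, of "{i. fst i = snd i}"] show ?thesis
      by (simp add: vimage_def Int_def conj_commute)
  qed
  have "prob {\<omega> \<in> space M. gap z 0 \<omega> \<le> \<tau>'} - prob {\<omega> \<in> space M. gap z 0 \<omega> \<le> \<tau>}
      = prob ({\<omega> \<in> space M. gap z 0 \<omega> \<le> \<tau>'} - {\<omega> \<in> space M. gap z 0 \<omega> \<le> \<tau>})"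
    using \<tau> by (subst finite_measure_Diff) auto
  also have "\<dots> \<le> prob (space M - {\<omega> \<in> space M. rings z \<tau> \<omega> = rings z \<tau>' \<omega>})"
  proof (rule finite_measure_mono_AE)
    show "AE \<omega> in M. \<omega> \<in> {\<omega> \<in> space M. gap z 0 \<omega> \<le> \<tau>'} - {\<omega> \<in> space M. gap z 0 \<omega> \<le> \<tau>}
        \<longrightarrow> \<omega> \<in> space M - {\<omega> \<in> space M. rings z \<tau> \<omega> = rings z \<tau>' \<omega>}"
      using AE_gaps[OF z]
    proof eventually_elim
      case (elim \<omega>)
      show ?case
      proof
        assume a: "\<omega> \<in> {\<omega> \<in> space M. gap z 0 \<omega> \<le> \<tau>'} - {\<omega> \<in> space M. gap z 0 \<omega> \<le> \<tau>}"
        \<comment> \<open>Finiteness excludes the default value 0 of \<open>card\<close> on infinite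
          sets, so strict inclusion of the sets of rings gives different counts.\<close>
        have "finite {n. ring_time gap z n \<omega> \<le> 1}" by (rule finite_ring_times) (use elim in auto)
        then have "finite {n. ring_time gap z n \<omega> \<le> \<tau>'}"
          by (rule finite_subset[rotated]) (use \<tau> in auto)
        moreover have "0 \<in> {n. ring_time gap z n \<omega> \<le> \<tau>'}" "0 \<notin> {n. ring_time gap z n \<omega> \<le> \<tau>}"
          using a by (auto simp: ring_time_def)
        moreover have "{n. ring_time gap z n \<omega> \<le> \<tau>} \<subseteq> {n. ring_time gap z n \<omega> \<le> \<tau>'}"
          using \<tau> by auto
        ultimately have "rings z \<tau> \<omega> < rings z \<tau>' \<omega>"
          unfolding rings_def by (intro psubset_card_mono) auto
        then show "\<omega> \<in> space M - {\<omega> \<in> space M. rings z \<tau> \<omega> = rings z \<tau>' \<omega>}" using a by auto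
      qed
    qed
  qed (use stay_sets in auto)
  also have "\<dots> = 1 - stay z \<tau> \<tau>'"
    unfolding stay_def by (rule prob_compl[OF stay_sets])
  finally have 1: "exp (- \<tau>) - exp (- \<tau>') \<le> 1 - stay z \<tau> \<tau>'"
    using exponential_distributedD_le[OF gap_exponential[OF z]] \<tau> by simp
  have "(\<tau>' - \<tau>) / 3 \<le> (\<tau>' - \<tau>) * exp (- \<tau>')"
  proof -
    have "exp \<tau>' \<le> exp 1" using \<tau> by simp
    also have "\<dots> \<le> 3" by (rule exp_le)
    finally have "1 / 3 \<le> exp (- \<tau>')" by (simp add: exp_minus field_simps)
    from mult_left_mono[OF this, of "\<tau>' - \<tau>"] \<tau> show ?thesis by simp
  qed
  also have "\<dots> \<le> (exp (\<tau>' - \<tau>) - 1) * exp (- \<tau>')"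
    by (rule mult_right_mono) (use exp_ge_add_one_self[of "\<tau>' - \<tau>"] in linarith, simp)
  also have "\<dots> = exp (- \<tau>) - exp (- \<tau>')"
    by (simp add: algebra_simps exp_diff exp_minus divide_inverse)
  finally show ?thesis using 1 by linarith
qed

section \<open>First and second moments of the exponential weights\<close>

lemma integrable_pos:
  fixes h :: "int \<Rightarrow> int \<Rightarrow> real"
  shows "integrable M (\<lambda>\<omega>. h (pos \<tau> n \<omega>) (pos \<tau>' n \<omega>))"
proof -
  note [measurable] = measurable_pos
  have "(\<lambda>\<omega>. (pos \<tau> n \<omega>, pos \<tau>' n \<omega>)) \<in> measurable M (count_space UNIV)" by measurable
  moreover have "(pos \<tau> n \<omega>, pos \<tau>' n \<omega>) \<in> {-int n..int n} \<times> {-int n..int n}" if "\<omega> \<in> space M" for \<omega>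
    using pos_in[OF that, of \<tau> n] pos_in[OF that, of \<tau>' n] by (simp add: abs_le_iff)
  ultimately show ?thesis
    using expectation_finite_values(1)[of "\<lambda>\<omega>. (pos \<tau> n \<omega>, pos \<tau>' n \<omega>)" "{-int n..int n} \<times> {-int n..int n}" "\<lambda>(x, y). h x y"]
    by simp
qed

lemma expectation_exp_pos:
  "expectation (\<lambda>\<omega>. exp (\<beta> * real_of_int (pos \<tau> n \<omega>))) = cosh \<beta> ^ n"
proof (rule antisym)
  \<comment> \<open>Summing over \<open>e'\<close> removes the correlation \<open>c\<close>, so this
    is an identity; \<open>s = 1\<close> and \<open>s = -1\<close> then give the two
    inequalities.\<close>
  have step: "(\<Sum>(e, e')\<in>{-1, 1} \<times> {-1, 1}. (1 + c * real_of_int (e * e')) / 4 * (s * exp (\<beta> * real_of_int (x + e))))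
    = cosh \<beta> * (s * exp (\<beta> * real_of_int x))" for x :: int and c s
    unfolding sum_signs cosh_field_def by (simp add: exp_add exp_diff exp_minus field_simps)
  show "expectation (\<lambda>\<omega>. exp (\<beta> * real_of_int (pos \<tau> n \<omega>))) \<le> cosh \<beta> ^ n"
    using expectation_le_power[of \<tau> \<tau> "\<lambda>x y. 1 * exp (\<beta> * real_of_int x)" "cosh \<beta>" n] step[of _ 1] by simp
  show "cosh \<beta> ^ n \<le> expectation (\<lambda>\<omega>. exp (\<beta> * real_of_int (pos \<tau> n \<omega>)))"
    using expectation_le_power[of \<tau> \<tau> "\<lambda>x y. - 1 * exp (\<beta> * real_of_int x)" "cosh \<beta>" n] step[of _ "-1"] by simp
qed

text \<open>The perturbed weight dominates the product of the exponentials, starts at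
  \<open>1 + a\<close>, and grows per step by the factor of \<open>supersolution\<close>. The 6 in
  \<open>small\<close> is the 3 of \<open>stay_le\<close> times the 2 in
  \<open>(1 - c) / 2\<close>.\<close>

lemma expectation_exp_pos_pos_le:
  fixes a \<beta> \<theta> :: real
  assumes \<tau>: "0 \<le> \<tau>" "\<tau> \<le> \<tau>'" "\<tau>' \<le> 1" and a: "0 \<le> a" and \<theta>: "0 \<le> \<theta>"
    and small: "(1 + a) * (sinh \<beta>)\<^sup>2 \<le> (\<tau>' - \<tau>) / 6 * (a * (1 - exp (- 2 * \<theta>)))"
  shows "expectation (\<lambda>\<omega>. exp (\<beta> * real_of_int (pos \<tau> n \<omega>)) * exp (\<beta> * real_of_int (pos \<tau>' n \<omega>)))
    \<le> (1 + a) * cosh \<theta> ^ (2 * n) * (cosh \<beta> ^ n)\<^sup>2"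
proof -
  define w where "w = (\<lambda>x y :: int. exp (\<beta> * real_of_int (x + y)) * (1 + a * exp (- \<theta> * \<bar>real_of_int (x - y)\<bar>)))"
  have "expectation (\<lambda>\<omega>. exp (\<beta> * real_of_int (pos \<tau> n \<omega>)) * exp (\<beta> * real_of_int (pos \<tau>' n \<omega>)))
    \<le> expectation (\<lambda>\<omega>. w (pos \<tau> n \<omega>) (pos \<tau>' n \<omega>))"
  proof (rule integral_mono)
    show "exp (\<beta> * real_of_int (pos \<tau> n \<omega>)) * exp (\<beta> * real_of_int (pos \<tau>' n \<omega>)) \<le> w (pos \<tau> n \<omega>) (pos \<tau>' n \<omega>)" for \<omega>
      using a by (simp add: w_def distrib_left exp_add)
  qed (rule integrable_pos)+
  also have "\<dots> \<le> ((cosh \<beta>)\<^sup>2 * (cosh \<theta>)\<^sup>2) ^ n * w 0 0"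
  proof (rule expectation_le_power)
    fix m x y assume z: "(x, int m) \<in> Z2even" "(y, int m) \<in> Z2even"
    let ?c = "corr (x, int m) (y, int m) \<tau> \<tau>'"
    have "0 \<le> stay (x, int m) \<tau> \<tau>'" "stay (x, int m) \<tau> \<tau>' \<le> 1"
      by (simp_all add: stay_def)
    then have c: "x \<noteq> y \<Longrightarrow> ?c = 0" "0 \<le> ?c" "?c \<le> 1" by (auto simp: corr_def)
    have "(\<tau>' - \<tau>) / 6 * (a * (1 - exp (- 2 * \<theta>))) \<le> (1 - ?c) / 2 * (a * (1 - exp (- 2 * \<theta>)))" if "x = y"
    proof (rule mult_right_mono)
      have "?c = stay (x, int m) \<tau> \<tau>'" using that by (simp add: corr_def)
      then show "(\<tau>' - \<tau>) / 6 \<le> (1 - ?c) / 2" using stay_le[OF z(1) \<tau>] by (simp add: field_simps)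
    qed (use a \<theta> in simp)
    then have small': "x = y \<Longrightarrow> (1 + a) * (sinh \<beta>)\<^sup>2 \<le> (1 - ?c) / 2 * (a * (1 - exp (- 2 * \<theta>)))"
      using small by linarith
    have "even (x - y)" using z by (auto simp: Z2even_def)
    from supersolution[OF this a c small']
    show "(\<Sum>(e, e')\<in>{-1, 1} \<times> {-1, 1}. (1 + ?c * real_of_int (e * e')) / 4 * w (x + e) (y + e'))
      \<le> (cosh \<beta>)\<^sup>2 * (cosh \<theta>)\<^sup>2 * w x y" unfolding w_def .
  qed simp
  finally show ?thesis
    by (simp add: w_def power_mult_distrib power_mult[symmetric] mult_ac)
qed

text \<open>The factor 4 is Chebyshev's for a deviation of 1/2: if all normalised weights are at
  most 1/2, so is their average \<open>Z\<close>, whose mean is 1. The rest bounds the variance of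
  \<open>Z\<close>.\<close>

lemma prob_all_low_le:
  fixes a \<beta> \<theta> \<delta> :: real and t :: "nat \<Rightarrow> real"
  assumes N: "0 < N" and t: "\<And>i. i < N \<Longrightarrow> 0 \<le> t i \<and> t i \<le> 1"
    and \<delta>: "\<And>i j. i < j \<Longrightarrow> j < N \<Longrightarrow> \<delta> \<le> t j - t i" "0 \<le> \<delta>"
    and a: "0 \<le> a" and \<theta>: "0 \<le> \<theta>"
    and small: "(1 + a) * (sinh \<beta>)\<^sup>2 \<le> \<delta> / 6 * (a * (1 - exp (- 2 * \<theta>)))"
  shows "prob {\<omega> \<in> space M. \<forall>i<N. exp (\<beta> * real_of_int (pos (t i) n \<omega>)) \<le> cosh \<beta> ^ n / 2}
    \<le> 4 * ((cosh (2 * \<beta>) / (cosh \<beta>)\<^sup>2) ^ n / real N + (1 + a) * cosh \<theta> ^ (2 * n) - 1)"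
proof -
  note [measurable] = measurable_pos
  define A where "A = (1 + a) * cosh \<theta> ^ (2 * n)"
  define B where "B = (cosh (2 * \<beta>) / (cosh \<beta>)\<^sup>2) ^ n"
  have A: "0 \<le> A" using a by (simp add: A_def)
  define L where "L i \<omega> = exp (\<beta> * real_of_int (pos (t i) n \<omega>)) / cosh \<beta> ^ n" for i \<omega>
  define Z where "Z \<omega> = (\<Sum>i<N. L i \<omega>) / real N" for \<omega>
  have L1: "integrable M (L i)" for i
    unfolding L_def by (rule integrable_pos)
  have L2: "integrable M (\<lambda>\<omega>. L i \<omega> * L j \<omega>)" for i j
    unfolding L_def by (rule integrable_pos)
  have EL: "expectation (L i) = 1" for i
    unfolding L_def by (simp add: expectation_exp_pos)
  have ELL_less: "expectation (\<lambda>\<omega>. L i \<omega> * L j \<omega>) \<le> A" if "i < j" "j < N" for i j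
  proof -
    have "\<delta> / 6 * (a * (1 - exp (- 2 * \<theta>))) \<le> (t j - t i) / 6 * (a * (1 - exp (- 2 * \<theta>)))"
      using \<delta>(1)[OF that] a \<theta> by (intro mult_right_mono) auto
    with small have "(1 + a) * (sinh \<beta>)\<^sup>2 \<le> (t j - t i) / 6 * (a * (1 - exp (- 2 * \<theta>)))" by linarith
    moreover have "t i \<le> t j" using \<delta>(1)[OF that] \<delta>(2) by linarith
    ultimately have "expectation (\<lambda>\<omega>. exp (\<beta> * real_of_int (pos (t i) n \<omega>)) * exp (\<beta> * real_of_int (pos (t j) n \<omega>)))
      \<le> A * (cosh \<beta> ^ n)\<^sup>2"
      unfolding A_def using t[of i] t[of j] that a \<theta> by (intro expectation_exp_pos_pos_le) auto
    moreover have "expectation (\<lambda>\<omega>. L i \<omega> * L j \<omega>) =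
      expectation (\<lambda>\<omega>. exp (\<beta> * real_of_int (pos (t i) n \<omega>)) * exp (\<beta> * real_of_int (pos (t j) n \<omega>))) / (cosh \<beta> ^ n)\<^sup>2"
      by (simp add: L_def power2_eq_square)
    ultimately show ?thesis by (simp add: pos_divide_le_eq)
  qed
  have ELL_eq: "expectation (\<lambda>\<omega>. L i \<omega> * L i \<omega>) = B" for i
  proof -
    \<comment> \<open>Squaring a weight doubles its tilt, so the first-moment formula applies
      again.\<close>
    have "(\<lambda>\<omega>. L i \<omega> * L i \<omega>) = (\<lambda>\<omega>. exp ((2 * \<beta>) * real_of_int (pos (t i) n \<omega>)) / (cosh \<beta> ^ n)\<^sup>2)"
      by (simp add: L_def power2_eq_square exp_add[symmetric] fun_eq_iff)
    then show ?thesis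
      by (simp add: expectation_exp_pos B_def power_divide power_mult[symmetric] mult.commute del: times_divide_eq_left)
  qed
  \<comment> \<open>Charging \<open>A\<close> on the diagonal as well lets the double sum split into
    \<open>N\<^sup>2 * A\<close> and \<open>N * B\<close>.\<close>
  have ELL: "expectation (\<lambda>\<omega>. L i \<omega> * L j \<omega>) \<le> A + (if i = j then B else 0)" if "i < N" "j < N" for i j
    using ELL_less[of i j] ELL_less[of j i] ELL_eq[of i] that A
    by (cases i j rule: linorder_cases) (auto simp: mult.commute)
  have Z2: "(\<lambda>\<omega>. (Z \<omega>)\<^sup>2) = (\<lambda>\<omega>. (\<Sum>i<N. \<Sum>j<N. L i \<omega> * L j \<omega>) / (real N)\<^sup>2)"
    by (simp add: Z_def power_divide power2_eq_square sum_product fun_eq_iff)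
  have int_Z: "integrable M Z" unfolding Z_def using L1 by simp
  have int_Z2: "integrable M (\<lambda>\<omega>. (Z \<omega>)\<^sup>2)" unfolding Z2 using L2 by simp
  have EZ: "expectation Z = 1"
    unfolding Z_def using N by (simp add: Bochner_Integration.integral_sum[OF L1] EL)
  have "expectation (\<lambda>\<omega>. (Z \<omega>)\<^sup>2) = (\<Sum>i<N. \<Sum>j<N. expectation (\<lambda>\<omega>. L i \<omega> * L j \<omega>)) / (real N)\<^sup>2"
    unfolding Z2 by (simp add: Bochner_Integration.integral_sum L2)
  also have "\<dots> \<le> (\<Sum>i<N. \<Sum>j<N. A + (if i = j then B else 0)) / (real N)\<^sup>2"
    by (intro divide_right_mono sum_mono ELL) auto
  also have "\<dots> = B / real N + A"
    using N by (simp add: sum.distrib field_simps power2_eq_square)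
  finally have var: "variance Z \<le> B / real N + A - 1"
    using variance_eq[OF int_Z int_Z2] EZ by simp
  have "prob {\<omega> \<in> space M. \<forall>i<N. exp (\<beta> * real_of_int (pos (t i) n \<omega>)) \<le> cosh \<beta> ^ n / 2}
    \<le> prob {\<omega> \<in> space M. 1 / 2 \<le> \<bar>Z \<omega> - expectation Z\<bar>}"
  proof (rule finite_measure_mono)
    show "{\<omega> \<in> space M. 1 / 2 \<le> \<bar>Z \<omega> - expectation Z\<bar>} \<in> sets M"
      using int_Z by measurable
    show "{\<omega> \<in> space M. \<forall>i<N. exp (\<beta> * real_of_int (pos (t i) n \<omega>)) \<le> cosh \<beta> ^ n / 2}
      \<subseteq> {\<omega> \<in> space M. 1 / 2 \<le> \<bar>Z \<omega> - expectation Z\<bar>}"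
    proof clarsimp
      fix \<omega> assume "\<forall>i<N. exp (\<beta> * real_of_int (pos (t i) n \<omega>)) * 2 \<le> cosh \<beta> ^ n"
      then have "(\<Sum>i<N. L i \<omega>) \<le> (\<Sum>i<N. 1 / 2)"
        by (intro sum_mono) (simp add: L_def divide_le_eq)
      then have "Z \<omega> \<le> 1 / 2" using N by (simp add: Z_def field_simps)
      then show "1 \<le> \<bar>Z \<omega> - expectation Z\<bar> * 2" by (simp add: EZ)
    qed
  qed
  also have "\<dots> \<le> variance Z / (1 / 2)\<^sup>2"
    by (rule Chebyshev_inequality) (use int_Z int_Z2 in auto)
  also have "\<dots> \<le> 4 * (B / real N + A - 1)" using var by (simp add: power2_eq_square)
  finally show ?thesis by (simp add: A_def B_def)
qed

section \<open>Exceptional times\<close>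

lemma AE_exists_high:
  fixes a b :: real
  assumes ab: "0 \<le> a" "a < b" "b \<le> 1"
  shows "AE \<omega> in M. \<exists>\<tau>\<in>{a<..<b}. \<exists>n\<ge>T. 1 / 64 * sqrt (real n * ln (real n)) \<le> real_of_int (pos \<tau> n \<omega>)"
proof -
  note [measurable] = measurable_pos
  \<comment> \<open>The shifts by 1 keep all times strictly inside the interval from
    \<open>a\<close> to \<open>b\<close>.\<close>
  define t where "t N i = a + (b - a) * (real i + 1) / (real N + 1)" for N i :: nat
  define low where "low N \<omega> \<longleftrightarrow> (\<forall>i<N. exp (tilt N * real_of_int (pos (t N i) (N ^ 4) \<omega>)) \<le> cosh (tilt N) ^ (N ^ 4) / 2)" for N \<omega>
  define f where "f N = 4 * ((cosh (2 * tilt N) / (cosh (tilt N))\<^sup>2) ^ (N ^ 4) / real N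
    + (1 + real N powr (-1/4)) * cosh (real N powr (-5/2)) ^ (2 * N ^ 4) - 1)" for N
  have low [measurable]: "Measurable.pred M (low N)" for N unfolding low_def by measurable
  have t: "a < t N i" "t N i < b" if "i < N" for N i
  proof -
    have "(b - a) * ((real i + 1) / (real N + 1)) < (b - a) * 1"
      using that ab by (intro mult_strict_left_mono) auto
    then show "t N i < b" by (simp add: t_def)
    show "a < t N i" using ab by (simp add: t_def)
  qed
  have spacing: "(b - a) / (real N + 1) \<le> t N j - t N i" if "i < j" for N i j
  proof -
    have "real i + 1 \<le> real j" using that by linarith
    then have "(b - a) * 1 / (real N + 1) \<le> (b - a) * (real j - real i) / (real N + 1)"
      using ab by (intro divide_right_mono mult_left_mono) auto
    also have "\<dots> = t N j - t N i" by (simp add: t_def diff_divide_distrib[symmetric] algebra_simps)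
    finally show ?thesis by simp
  qed
  have prob_low: "\<forall>\<^sub>F N in sequentially. prob {\<omega> \<in> space M. low N \<omega>} \<le> f N"
  proof -
    have "0 < b - a" using ab by simp
    from eventually_tilt_small[OF this] eventually_gt_at_top[of 0] show ?thesis
    proof eventually_elim
      case (elim N)
      show ?case
        unfolding low_def f_def
      proof (rule prob_all_low_le[OF elim(2) _ spacing _ _ _ elim(1)])
        show "0 \<le> t N i \<and> t N i \<le> 1" if "i < N" for i
          using t[OF that] ab by auto
      qed (use ab in auto)
    qed
  qed
  \<comment> \<open>The event that \<open>low N\<close> holds for all \<open>N \<ge> T'\<close> lies
    in each single event \<open>low N\<close>, whose probability tends to 0.\<close>
  have "AE \<omega> in M. \<exists>N\<ge>T'. \<not> low N \<omega>" for T'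
  proof -
    have "\<forall>\<^sub>F N in sequentially. prob {\<omega> \<in> space M. \<forall>N\<ge>T'. low N \<omega>} \<le> f N"
      using prob_low eventually_ge_at_top[of T']
    proof eventually_elim
      case (elim N)
      have "prob {\<omega> \<in> space M. \<forall>N\<ge>T'. low N \<omega>} \<le> prob {\<omega> \<in> space M. low N \<omega>}"
        using elim by (intro finite_measure_mono) auto
      with elim show ?case by linarith
    qed
    then have "prob {\<omega> \<in> space M. \<forall>N\<ge>T'. low N \<omega>} \<le> 0"
      using second_moment_tendsto unfolding f_def[symmetric]
      by (intro tendsto_lowerbound[of f]) auto
    then have "prob {\<omega> \<in> space M. \<forall>N\<ge>T'. low N \<omega>} = 0"
      using measure_nonneg by (rule antisym)
    then have "AE \<omega> in M. \<not> (\<forall>N\<ge>T'. low N \<omega>)"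
      by (subst (asm) prob_Collect_eq_0) auto
    then show ?thesis by simp
  qed
  moreover obtain T' where T': "\<And>N. N \<ge> T' \<Longrightarrow> N \<ge> T \<and> 0 < N \<and> 0 < tilt N \<and>
      1 / 64 * sqrt (real (N ^ 4) * ln (real (N ^ 4))) \<le> (real (N ^ 4) * ln (cosh (tilt N)) - ln 2) / tilt N"
  proof -
    have "\<forall>\<^sub>F N in sequentially. 0 < tilt N"
      by (rule eventually_compose_filterlim[OF eventually_at_right_less tilt_at_right])
    with eventually_height eventually_ge_at_top[of T] eventually_gt_at_top[of 0]
    have "\<forall>\<^sub>F N in sequentially. N \<ge> T \<and> 0 < N \<and> 0 < tilt N \<and>
      1 / 64 * sqrt (real (N ^ 4) * ln (real (N ^ 4))) \<le> (real (N ^ 4) * ln (cosh (tilt N)) - ln 2) / tilt N"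
      by eventually_elim simp
    then show ?thesis using that unfolding eventually_sequentially by blast
  qed
  ultimately have "AE \<omega> in M. \<exists>N\<ge>T'. \<not> low N \<omega>" by blast
  then show ?thesis
  proof eventually_elim
    case (elim \<omega>)
    then obtain N i where N: "N \<ge> T'" and i: "i < N"
      and high: "cosh (tilt N) ^ (N ^ 4) / 2 < exp (tilt N * real_of_int (pos (t N i) (N ^ 4) \<omega>))"
      unfolding low_def not_all not_imp not_le by blast
    have "1 / 64 * sqrt (real (N ^ 4) * ln (real (N ^ 4))) \<le> real_of_int (pos (t N i) (N ^ 4) \<omega>)"
      using T'[OF N] by (intro cosh_half_less_exp_imp_high[OF _ high]) auto
    moreover have "T \<le> N ^ 4"
    proof -
      have "T \<le> N ^ 1" using T'[OF N] by simp
      also have "\<dots> \<le> N ^ 4" using T'[OF N] by (intro power_increasing) auto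
      finally show ?thesis .
    qed
    ultimately show ?case using t[OF i] by (intro bexI[of _ "t N i"] exI[of _ "N ^ 4"]) auto
  qed
qed

section \<open>Right-continuity in dynamical time and the Baire argument\<close>

text \<open>Among the finitely many ring times in \<open>[0, 1]\<close>, those beyond
  \<open>\<tau>\<close> stay beyond every \<open>\<tau>'\<close> close enough on the right; all
  others exceed 1.\<close>

lemma eventually_rings_eq:
  assumes gaps: "\<forall>n. gap z n \<omega> > 0" "\<exists>n. gap z n \<omega> > 1" and "\<tau> < 1"
  shows "\<forall>\<^sub>F \<tau>' in at_right \<tau>. rings z \<tau>' \<omega> = rings z \<tau> \<omega>"
proof -
  let ?F = "{n. ring_time gap z n \<omega> \<le> 1}"
  have "finite ?F" by (rule finite_ring_times) (use gaps in auto)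
  moreover have "\<forall>\<^sub>F \<tau>' in at_right \<tau>. ring_time gap z n \<omega> \<le> \<tau>' \<longrightarrow> ring_time gap z n \<omega> \<le> \<tau>" for n
  proof (cases "ring_time gap z n \<omega> \<le> \<tau>")
    case False
    then show ?thesis
      unfolding eventually_at_right[OF \<open>\<tau> < 1\<close>] by (intro exI[of _ "ring_time gap z n \<omega>"]) auto
  qed auto
  ultimately have "\<forall>\<^sub>F \<tau>' in at_right \<tau>. \<forall>n\<in>?F. ring_time gap z n \<omega> \<le> \<tau>' \<longrightarrow> ring_time gap z n \<omega> \<le> \<tau>"
    by (intro eventually_ball_finite) auto
  moreover have "\<forall>\<^sub>F \<tau>' in at_right \<tau>. \<tau> < \<tau>' \<and> \<tau>' < 1"
    unfolding eventually_at_right[OF \<open>\<tau> < 1\<close>] using \<open>\<tau> < 1\<close> by blast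
  ultimately show ?thesis
  proof eventually_elim
    case (elim \<tau>')
    then have "{n. ring_time gap z n \<omega> \<le> \<tau>'} = {n. ring_time gap z n \<omega> \<le> \<tau>}" by fastforce
    then show ?case by (simp add: rings_def)
  qed
qed

lemma eventually_pos_eq:
  assumes gaps: "\<forall>z\<in>Z2even. (\<forall>n. gap z n \<omega> > 0) \<and> (\<exists>n. gap z n \<omega> > 1)" and "\<tau> < 1" and \<omega>: "\<omega> \<in> space M"
  shows "\<forall>\<^sub>F \<tau>' in at_right \<tau>. pos \<tau>' n \<omega> = pos \<tau> n \<omega>"
proof -
  have "\<forall>\<^sub>F \<tau>' in at_right \<tau>. \<forall>z\<in>light_cone n. rings z \<tau>' \<omega> = rings z \<tau> \<omega>"
    by (intro eventually_ball_finite finite_light_cone ballI eventually_rings_eq)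
      (use gaps \<open>\<tau> < 1\<close> in \<open>auto simp: light_cone_def\<close>)
  then show ?thesis
  proof eventually_elim
    case (elim \<tau>')
    show ?case unfolding pos_def
      by (rule walk_cong[where n = n]) (use arrow_in[OF _ \<omega>] elim in \<open>auto simp: arrow_rings\<close>)
  qed
qed

text \<open>Just to the right of a high time lies an open interval of high times, so the interior of
  \<open>V T\<close> is dense in \<open>[0, 1]\<close> although \<open>V T\<close> itself may fail
  to be open. Rational end points in \<open>high\<close> allow one null set for all
  intervals.\<close>

lemma exceptional_time_exists:
  assumes \<omega>: "\<omega> \<in> space M"
    and gaps: "\<forall>z\<in>Z2even. (\<forall>n. gap z n \<omega> > 0) \<and> (\<exists>n. gap z n \<omega> > 1)"
    and high: "\<And>a b T. a \<in> \<rat> \<Longrightarrow> b \<in> \<rat> \<Longrightarrow> 0 \<le> a \<Longrightarrow> a < b \<Longrightarrow> b \<le> 1 \<Longrightarrow>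
      \<exists>\<tau>\<in>{a<..<b}. \<exists>n\<ge>T. P n (pos \<tau> n \<omega>)"
  shows "\<exists>\<tau>\<in>{0..1}. \<forall>T. \<exists>n\<ge>T. P n (pos \<tau> n \<omega>)"
proof -
  define V where "V T = {\<tau>. \<exists>n\<ge>T. P n (pos \<tau> n \<omega>)}" for T :: nat
  define G where "G T = {0..1} \<inter> interior (V T)" for T
  have dense: "\<exists>y\<in>G T. a < y \<and> y < b" if ab: "0 \<le> a" "a < b" "b \<le> 1" for T a b
  proof -
    \<comment> \<open>Shrink to rational end points, the only ones for which \<open>high\<close>
      speaks.\<close>
    obtain p where p: "p \<in> \<rat>" "a < p" "p < b" using Rats_dense_in_real[OF ab(2)] by blast
    obtain q where q: "q \<in> \<rat>" "p < q" "q < b" using Rats_dense_in_real[OF p(3)] by blast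
    obtain \<tau> n where \<tau>: "p < \<tau>" "\<tau> < q" and n: "n \<ge> T" "P n (pos \<tau> n \<omega>)"
      using high[OF p(1) q(1), of T] p q ab by auto
    have "\<tau> < 1" using \<tau> q ab by simp
    then obtain c where c: "c > \<tau>" "\<And>\<tau>'. \<tau> < \<tau>' \<Longrightarrow> \<tau>' < c \<Longrightarrow> pos \<tau>' n \<omega> = pos \<tau> n \<omega>"
      using eventually_pos_eq[OF gaps _ \<omega>, of \<tau> n] unfolding eventually_at_right[OF \<open>\<tau> < 1\<close>] by blast
    have "{\<tau><..<c} \<subseteq> V T" using n c(2) by (auto simp: V_def)
    then have "{\<tau><..<c} \<subseteq> interior (V T)" by (rule interior_maximal) simp
    \<comment> \<open>Here \<open>dense\<close> is the density of the order on the reals; the local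
      fact of that name is only being proved.\<close>
    moreover obtain y where "\<tau> < y" "y < min c q" using dense[of \<tau> "min c q"] c \<tau> by auto
    ultimately show ?thesis using \<tau> p q ab by (intro bexI[of _ y]) (auto simp: G_def)
  qed
  have "{0..1} \<subseteq> closure (\<Inter>(range G))"
  proof (rule Baire)
    fix U assume "U \<in> range G"
    then obtain T where U: "U = G T" by blast
    have "x \<in> closure (G T)" if "x \<in> {0..1}" for x
      unfolding closure_approachable
    proof (intro allI impI)
      fix e :: real assume "e > 0"
      \<comment> \<open>Cutting the ball down to \<open>[0, 1]\<close> covers the end points 0 and 1
        too.\<close>
      with that have "max 0 (x - e) < min 1 (x + e)" by auto
      from dense[OF _ this, of T] show "\<exists>y\<in>G T. dist y x < e"
        by (force simp: dist_real_def)
    qed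
    then show "openin (top_of_set {0..1}) U \<and> {0..1} \<subseteq> closure U"
      unfolding U by (auto simp: G_def)
  qed auto
  then have "\<Inter>(range G) \<noteq> {}" by (metis atLeastAtMost_iff closure_empty empty_iff subsetD zero_le_one order_refl)
  then obtain \<tau> where \<tau>: "\<And>T. \<tau> \<in> G T" by blast
  have "\<tau> \<in> V T" for T using \<tau>[of T] interior_subset by (auto simp: G_def)
  then show ?thesis using \<tau>[of 0] by (intro bexI[of _ \<tau>]) (auto simp: G_def V_def)
qed

end

section \<open>The upper limit along integers and the conclusion\<close>

lemma Limsup_at_top_geI:
  fixes f :: "real \<Rightarrow> ereal"
  assumes "\<And>T. \<exists>n\<ge>T. C \<le> f (real n)"
  shows "C \<le> Limsup at_top f"
  unfolding Limsup_def
proof (rule INF_greatest)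
  fix P :: "real \<Rightarrow> bool" assume "P \<in> {P. eventually P at_top}"
  then obtain x where x: "\<And>y. y \<ge> x \<Longrightarrow> P y" by (auto simp: eventually_at_top_linorder)
  obtain n where n: "n \<ge> nat \<lceil>x\<rceil>" "C \<le> f (real n)" using assms by blast
  have "P (real n)" using n by (intro x) linarith
  then show "C \<le> (SUP y\<in>Collect P. f y)" using n(2) by (intro SUP_upper2[of "real n"]) auto
qed

theorem theorem2:
  fixes M :: "'a measure"
    and mark :: "int \<times> int \<Rightarrow> nat \<Rightarrow> 'a \<Rightarrow> int"
    and gap :: "int \<times> int \<Rightarrow> nat \<Rightarrow> 'a \<Rightarrow> real"
  assumes "dynamical_discrete_web M mark gap"
  shows "\<exists>C0::real. C0 > 0 \<and> (\<forall>C. 0 < C \<and> C \<le> C0 \<longrightarrow>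
    (AE \<omega> in M. \<exists>\<tau>\<in>{0..1::real}.
      Limsup at_top (\<lambda>t::real. ereal (web_path mark gap (0, 0) \<tau> \<omega> t / sqrt (t * ln t))) \<ge> ereal C))"
proof -
  interpret dynamical_discrete_web M mark gap by fact
  let ?P = "\<lambda>n k. 1 / 64 * sqrt (real n * ln (real n)) \<le> real_of_int k"
  have "AE \<omega> in M. \<forall>z\<in>Z2even. (\<forall>n. gap z n \<omega> > 0) \<and> (\<exists>n. gap z n \<omega> > 1)"
    by (intro AE_ball_countable' AE_gaps) auto
  \<comment> \<open>Rational end points and integer levels form a countable set, so a single null
    set serves them all.\<close>
  moreover have "AE \<omega> in M. \<forall>I\<in>(\<rat> \<times> \<rat>) \<times> (UNIV :: nat set). 0 \<le> fst (fst I) \<and> fst (fst I) < snd (fst I) \<and> snd (fst I) \<le> 1 \<longrightarrow>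
      (\<exists>\<tau>\<in>{fst (fst I)<..<snd (fst I)}. \<exists>n\<ge>snd I. ?P n (pos \<tau> n \<omega>))"
    by (intro AE_ball_countable' AE_impI AE_exists_high) (auto intro!: countable_SIGMA countable_rat)
  ultimately have exceptional: "AE \<omega> in M. \<exists>\<tau>\<in>{0..1}. \<forall>T. \<exists>n\<ge>T. ?P n (pos \<tau> n \<omega>)"
    using AE_space
  proof eventually_elim
    case (elim \<omega>)
    show ?case
      by (rule exceptional_time_exists) (use elim in \<open>force+\<close>)
  qed
  show ?thesis
  \<comment> \<open>\<open>1 / 64\<close> is the constant of \<open>eventually_height\<close>; one
    exceptional time serves every smaller \<open>C\<close>.\<close>
  proof (intro exI[of _ "1 / 64"] conjI allI impI)
    fix C :: real assume C: "0 < C \<and> C \<le> 1 / 64"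
    show "AE \<omega> in M. \<exists>\<tau>\<in>{0..1}.
      Limsup at_top (\<lambda>t. ereal (web_path mark gap (0, 0) \<tau> \<omega> t / sqrt (t * ln t))) \<ge> ereal C"
      using exceptional
    proof eventually_elim
      case (elim \<omega>)
      then obtain \<tau> where \<tau>: "\<tau> \<in> {0..1}" "\<And>T. \<exists>n\<ge>T. ?P n (pos \<tau> n \<omega>)" by blast
      have "ereal C \<le> Limsup at_top (\<lambda>t. ereal (web_path mark gap (0, 0) \<tau> \<omega> t / sqrt (t * ln t)))"
      proof (rule Limsup_at_top_geI)
        fix T
        \<comment> \<open>From \<open>n \<ge> 2\<close> on, \<open>ln n\<close> is positive and the
          quotient is no division by 0.\<close>
        obtain n where n: "n \<ge> max T 2" "?P n (pos \<tau> n \<omega>)" using \<tau>(2) by blast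
        have pos: "0 < sqrt (real n * ln (real n))" using n by simp
        have "C * sqrt (real n * ln (real n)) \<le> 1 / 64 * sqrt (real n * ln (real n))"
          using C pos by (intro mult_right_mono) auto
        also have "\<dots> \<le> web_path mark gap (0, 0) \<tau> \<omega> (real n)"
          using n(2) by (simp add: web_path_of_nat pos_def)
        finally have "C \<le> web_path mark gap (0, 0) \<tau> \<omega> (real n) / sqrt (real n * ln (real n))"
          using pos by (simp add: pos_le_divide_eq)
        then show "\<exists>n\<ge>T. ereal C \<le> ereal (web_path mark gap (0, 0) \<tau> \<omega> (real n) / sqrt (real n * ln (real n)))"
          using n(1) by auto
      qed
      with \<tau>(1) show ?case by blast
    qed
  qed simp
qed

end
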